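(* Let $d\in\mathbb N$, $0<p,q,r\le\infty$ and $\psi\in B$. In the case $p<q$ assume, moreover, that for all $t$ larger than a certain number $t_0$, $\psi(t)$ is convex and satisfies $$\frac{t|\psi'(t)|}{\psi(t)}\ge\beta,\qquad \psi'(t):=\psi'(t+),$$ with a certain $\beta>d\big(\frac1p-\frac1q\big)$. Then $$\mathscr D_m(\mathcal F_{q,r}^\psi)_{\mathcal S^p}\asymp\begin{cases}\psi(m^{1/d}),&0<q\le p\le\infty,\\ \psi(m^{1/d})\,m^{\frac1p-\frac1q},&0<p<q\le\infty,\end{cases}$$ and $$\sigma_m(\mathcal F_{q,r}^\psi)_{\mathcal S^p}\asymp\psi(m^{1/d})\,m^{\frac1p-\frac1q},\qquad 0<p,q\le\infty .$$
   Context: $1/\infty:=0$. $L_1=L_1(\mathbb T^d)$, $\mathbb T^d=[0,2\pi)^d$, is the space of functions integrable on $\mathbb T^d$ and $2\pi$-periodic in each variable; $e_k(x)=e^{i(k,x)}$, $\widehat f(k)=(2\pi)^{-d}\int_{\mathbb T^d}f\,\overline{e_k}\,dx$. For $0<p\le\infty$, $\mathcal S^p$ is the space of $f\in L_1$ with finite $\|f\|_{\mathcal S^p}=\|\{\widehat f(k)\}\|_{\ell_p(\mathbb Z^d)}$. For a positive non-increasing $\psi$ on $[1,\infty)$ and $0<q,r\le\infty$, set $\Psi_0=\psi(1)$, $\Psi_k=\psi(|k|_r)$ for $k\in\mathbb Z^d\setminus\{0\}$, where $|k|_r=\|k\|_{\ell_r^d}$ is the $\ell_r$-(quasi-)norm,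 and $\mathcal F_{q,r}^\psi=\{f\in L_1:\|\{\widehat f(k)/\Psi_k\}_{k}\|_{\ell_q(\mathbb Z^d)}\le1\}$. $\Gamma_m$ is the set of all collections $\gamma_m$ of $m$ different vectors of $\mathbb Z^d$; $E_{\gamma_m}(f)_{\mathcal S^p}=\inf_{c_k\in\mathbb C}\|f-\sum_{k\in\gamma_m}c_ke_k\|_{\mathcal S^p}$; $\mathscr D_m(\mathfrak N)_{\mathcal S^p}=\inf_{\gamma_m\in\Gamma_m}\sup_{f\in\mathfrak N}E_{\gamma_m}(f)_{\mathcal S^p}$ (basis width); $\sigma_m(\mathfrak N)_{\mathcal S^p}=\sup_{f\in\mathfrak N}\inf_{\gamma_m\in\Gamma_m}E_{\gamma_m}(f)_{\mathcal S^p}$ (best $m$-term approximation). $B$ is the set of all positive non-increasing functions $\psi(t)$, $t\ge1$, for which there is a constant $K$ with $1\le\psi(t)/\psi(2t)\le K$ for all $t\ge1$. $a(m)\asymp b(m)$ means there are constants $0<K_1<K_2$ independent of $m$ with $K_1b(m)\le a(m)\le K_2b(m)$ for all $m\in\mathbb N$. *)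

theory Defs
  imports "HOL-Analysis.Analysis"
begin

text \<open>
  Exponents range over \<open>0 < p \<le> \<infinity>\<close> and are values of type \<^typ>\<open>ennreal\<close>.
  The lattice of frequencies is \<^typ>\<open>int ^ 'd\<close>, the dimension being \<open>CARD('d)\<close>.
\<close>

text \<open>\<open>1/p\<close> as a real number, with \<open>1/\<infinity> = 0\<close>.\<close>

definition recip :: "ennreal \<Rightarrow> real" where
  "recip p = enn2real (inverse p)"

definition ennpowr :: "ennreal \<Rightarrow> real \<Rightarrow> ennreal" where
  "ennpowr x a = (if x = \<infinity> then \<infinity> else ennreal (enn2real x powr a))"

text \<open>
  The \<open>\<ell>\<^sub>p\<close> (quasi-)norm of a family over the whole type \<^typ>\<open>'i\<close>; the value \<open>\<infinity>\<close>
  means that the family is not in \<open>\<ell>\<^sub>p\<close>. It serves both for sequences on \<open>\<int>\<^sup>d\<close> and for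
  vectors in \<open>\<real>\<^sup>d\<close>. An \<^typ>\<open>ennreal\<close>-valued \<^const>\<open>infsum\<close> always converges.
\<close>

definition ell_norm :: "ennreal \<Rightarrow> ('i \<Rightarrow> 'a::real_normed_vector) \<Rightarrow> ennreal" where
  "ell_norm p a =
     (if p = \<infinity> then (SUP k. ennreal (norm (a k)))
      else ennpowr (\<Sum>\<^sub>\<infinity>k. ennreal (norm (a k) powr enn2real p)) (recip p))"

definition torus :: "(real ^ 'd::finite) set" where
  "torus = {x. \<forall>i. 0 \<le> x $ i \<and> x $ i < 2 * pi}"

definition L1 :: "(real ^ 'd::finite \<Rightarrow> complex) set" where
  "L1 = {f. f absolutely_integrable_on torus \<and> (\<forall>x i. f (x + axis i (2 * pi)) = f x)}"

definition expo :: "int ^ 'd::finite \<Rightarrow> real ^ 'd \<Rightarrow> complex" where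
  "expo k x = exp (\<i> * of_real (\<Sum>i\<in>UNIV. of_int (k $ i) * x $ i))"

definition fourier :: "(real ^ 'd::finite \<Rightarrow> complex) \<Rightarrow> int ^ 'd \<Rightarrow> complex" where
  "fourier f k =
     (LINT x:torus|lebesgue. f x * cnj (expo k x)) / of_real ((2 * pi) ^ CARD('d))"

definition Sp_norm :: "ennreal \<Rightarrow> (real ^ 'd::finite \<Rightarrow> complex) \<Rightarrow> ennreal" where
  "Sp_norm p f = ell_norm p (fourier f)"

text \<open>
  \<open>\<psi>\<close> is a total function here, but only its values on \<open>[1, \<infinity>)\<close> are ever used:
  \<open>|k|\<^sub>r \<ge> 1\<close> for every nonzero integer vector \<open>k\<close>.
\<close>

definition Psi :: "(real \<Rightarrow> real) \<Rightarrow> ennreal \<Rightarrow> int ^ 'd::finite \<Rightarrow> real" where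
  "Psi \<psi> r k =
     (if k = 0 then \<psi> 1 else \<psi> (enn2real (ell_norm r (\<lambda>i. real_of_int (k $ i)))))"

definition Fclass ::
  "ennreal \<Rightarrow> ennreal \<Rightarrow> (real \<Rightarrow> real) \<Rightarrow> (real ^ 'd::finite \<Rightarrow> complex) set" where
  "Fclass q r \<psi> = {f \<in> L1. ell_norm q (\<lambda>k. fourier f k / of_real (Psi \<psi> r k)) \<le> 1}"

definition Gam :: "nat \<Rightarrow> (int ^ 'd::finite) set set" where
  "Gam m = {\<gamma>. finite \<gamma> \<and> card \<gamma> = m}"

definition best_approx ::
  "ennreal \<Rightarrow> (int ^ 'd::finite) set \<Rightarrow> (real ^ 'd \<Rightarrow> complex) \<Rightarrow> ennreal" where
  "best_approx p \<gamma> f =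
     (INF c::int ^ 'd \<Rightarrow> complex. Sp_norm p (\<lambda>x. f x - (\<Sum>k\<in>\<gamma>. c k * expo k x)))"

definition basis_width ::
  "ennreal \<Rightarrow> (real ^ 'd::finite \<Rightarrow> complex) set \<Rightarrow> nat \<Rightarrow> ennreal" where
  "basis_width p N m = (INF \<gamma>\<in>Gam m. SUP f\<in>N. best_approx p \<gamma> f)"

definition mterm_approx ::
  "ennreal \<Rightarrow> (real ^ 'd::finite \<Rightarrow> complex) set \<Rightarrow> nat \<Rightarrow> ennreal" where
  "mterm_approx p N m = (SUP f\<in>N. INF \<gamma>\<in>Gam m. best_approx p \<gamma> f)"

definition class_B :: "(real \<Rightarrow> real) set" where
  "class_B = {\<psi>. (\<forall>t\<ge>1. 0 < \<psi> t) \<and> antimono_on {1..} \<psi> \<and>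
     (\<exists>K. \<forall>t\<ge>1. 1 \<le> \<psi> t / \<psi> (2 * t) \<and> \<psi> t / \<psi> (2 * t) \<le> K)}"

text \<open>
  Two-sided estimate for all \<open>m \<ge> 1\<close>, not merely eventually. The right-hand bound
  in particular makes \<open>a m\<close> finite.
\<close>

definition order_equiv :: "(nat \<Rightarrow> ennreal) \<Rightarrow> (nat \<Rightarrow> real) \<Rightarrow> bool" where
  "order_equiv a b \<longleftrightarrow> (\<exists>K1 K2. 0 < K1 \<and> K1 < K2 \<and>
     (\<forall>m\<ge>1. ennreal (K1 * b m) \<le> a m \<and> a m \<le> ennreal (K2 * b m)))"

end

theory Submission
  imports Defs
begin

text \<open>
  Subtracting \<open>c\<^sub>k e\<^sub>k\<close> changes only the coefficient at \<open>k\<close>, so the best approximation of \<open>f\<close> with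
  frequencies in \<open>\<gamma>\<close> is the \<open>\<ell>\<^sub>p\<close> norm of its Fourier coefficients off \<open>\<gamma>\<close>, and everything becomes a
  question on weighted sequences with weights \<open>\<Psi>\<^sub>k\<close>. Put \<open>L = m\<^sup>1\<^sup>/\<^sup>d\<close>. A cube \<open>Q\<close> of side about \<open>L / 2\<close>
  has at most \<open>m / 2\<close> points and \<open>\<Psi>\<^sub>k \<lesssim> \<psi>(L)\<close> off \<open>Q\<close>; a cube with at least \<open>2 m\<close> points and side of
  order \<open>L\<close> has \<open>\<psi>(L) \<lesssim> \<Psi>\<^sub>k\<close> on it. The lower bounds come from polynomials with equal coefficients
  on (a subset of) the larger cube. For the upper bounds of the basis width one takes \<open>\<gamma> \<supseteq> Q\<close>, and if
  \<open>p < q\<close> one applies Hoelder's inequality, with \<open>\<Sum>\<close> of \<open>\<Psi>\<^sub>k\<^sup>s\<close> over the complement of \<open>Q\<close>,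
  \<open>1/s = 1/p - 1/q\<close>, estimated over dyadic shells: the condition on \<open>\<psi>'\<close> says that
  \<open>t\<^sup>\<beta> \<psi>(t)\<close> decreases for large \<open>t\<close>. For \<open>\<sigma>\<^sub>m\<close> with \<open>q < p\<close> one removes the coefficients above the
  threshold \<open>V (m/2)\<^sup>-\<^sup>1\<^sup>/\<^sup>q\<close>, \<open>V \<asymp> \<psi>(L)\<close>.
\<close>

section \<open>The \<open>\<ell>\<^sub>p\<close> norms\<close>

lemma recip_eq: "p \<noteq> \<infinity> \<Longrightarrow> recip p = 1 / enn2real p"
  unfolding recip_def by (cases p; cases "p = 0") (auto simp: inverse_ennreal divide_inverse)

lemma enn2real_exponent_pos: "0 < p \<Longrightarrow> p \<noteq> \<infinity> \<Longrightarrow> 0 < enn2real p"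
  by (simp add: enn2real_positive_iff top.not_eq_extremum)

lemma recip_top [simp]: "recip top = 0"
  by (simp add: recip_def)

section \<open>Norm bounds as inequalities between finite sums\<close>

lemma ennpowr_le_iff:
  assumes "0 < a" "0 \<le> V"
  shows "ennpowr S (1 / a) \<le> ennreal V \<longleftrightarrow> S \<le> ennreal (V powr a)"
proof (cases S)
  case (real x)
  have "x powr (1 / a) \<le> V \<longleftrightarrow> x \<le> V powr a"
  proof
    assume "x powr (1 / a) \<le> V"
    then have "(x powr (1 / a)) powr a \<le> V powr a"
      using assms by (intro powr_mono2) auto
    then show "x \<le> V powr a" using assms real by (simp add: powr_powr)
  next
    assume "x \<le> V powr a"
    then have "x powr (1 / a) \<le> (V powr a) powr (1 / a)"
      using assms real by (intro powr_mono2) auto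
    then show "x powr (1 / a) \<le> V" using assms by (simp add: powr_powr)
  qed
  then show ?thesis using real assms by (simp add: ennpowr_def)
qed (simp add: ennpowr_def top_unique)

text \<open>A sum of nonnegative extended reals is the supremum of its finite subsums, so for finite
  \<open>p\<close> a norm bound becomes real arithmetic on finite sums. The estimates with finite
  exponents below all use this form.\<close>

lemma ell_norm_le_iff:
  assumes "0 < p" "p \<noteq> \<infinity>" "0 \<le> V"
  shows "ell_norm p a \<le> ennreal V \<longleftrightarrow>
    (\<forall>F. finite F \<longrightarrow> (\<Sum>k\<in>F. norm (a k) powr enn2real p) \<le> V powr enn2real p)"
proof -
  have p: "0 < enn2real p" using assms by (simp add: enn2real_exponent_pos)
  have "ell_norm p a \<le> ennreal V \<longleftrightarrow>
      (\<Sum>\<^sub>\<infinity>k. ennreal (norm (a k) powr enn2real p)) \<le> ennreal (V powr enn2real p)"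
    using assms p by (simp add: ell_norm_def recip_eq ennpowr_le_iff)
  also have "\<dots> \<longleftrightarrow> (\<forall>F. finite F \<longrightarrow> (\<Sum>k\<in>F. ennreal (norm (a k) powr enn2real p)) \<le> ennreal (V powr enn2real p))"
    by (subst nonneg_infsum_complete) (auto simp: SUP_le_iff)
  finally show ?thesis by (simp add: sum_nonneg)
qed

lemma ell_norm_infinity_le_iff:
  assumes "0 \<le> V"
  shows "ell_norm \<infinity> a \<le> ennreal V \<longleftrightarrow> (\<forall>k. norm (a k) \<le> V)"
  using assms by (simp add: ell_norm_def SUP_le_iff)

lemma norm_le_of_ell_norm_le:
  assumes "0 < p" "0 \<le> V" "ell_norm p a \<le> ennreal V"
  shows "norm (a k) \<le> V"
proof (cases "p = \<infinity>")
  case True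
  then show ?thesis using assms ell_norm_infinity_le_iff by blast
next
  case False
  have p: "0 < enn2real p" using assms False by (simp add: enn2real_exponent_pos)
  have "norm (a k) powr enn2real p \<le> V powr enn2real p"
    using assms(3) ell_norm_le_iff[OF assms(1) False assms(2), of a]
    by (auto dest: spec[where x = "{k}"])
  then show ?thesis using p assms powr_less_mono2[of "enn2real p" V "norm (a k)"] by linarith
qed

text \<open>The negation makes the norm finite, hence a real \<open>V\<close>, and the finite-sum
  criterion over \<open>F\<close> refutes it. For \<open>p = \<infinity>\<close> the power of the
  cardinality is 1, as \<open>recip\<close> vanishes there.\<close>

lemma ell_norm_ge_of_le_on:
  assumes "0 < p" "finite F" "F \<noteq> {}" "\<And>k. k \<in> F \<Longrightarrow> v \<le> norm (a k)" "0 \<le> v"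
  shows "ennreal (v * real (card F) powr recip p) \<le> ell_norm p a"
proof (rule ccontr)
  assume "\<not> ?thesis"
  then have lt: "ell_norm p a < ennreal (v * real (card F) powr recip p)" by simp
  then obtain V where V: "ell_norm p a = ennreal V" "0 \<le> V"
    by (metis ennreal_cases ennreal_less_top less_top order.strict_trans top.not_eq_extremum)
  have lt': "V < v * real (card F) powr recip p"
    using lt V by (simp add: ennreal_less_iff)
  have c: "0 < card F" using assms by (simp add: card_gt_0_iff)
  show False
  proof (cases "p = \<infinity>")
    case True
    obtain k where "k \<in> F" using assms by auto
    with norm_le_of_ell_norm_le[OF assms(1) V(2), of a k] V lt' assms(4)[of k] True c show False
      by simp
  next
    case False
    define x where "x = enn2real p"
    have x: "0 < x" using assms False by (simp add: enn2real_exponent_pos x_def)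
    have "V powr x < (v * real (card F) powr (1 / x)) powr x"
      using lt' False x V(2) by (intro powr_less_mono2) (auto simp: recip_eq x_def)
    also have "\<dots> = real (card F) * v powr x"
      using x c assms by (simp add: powr_mult powr_powr)
    also have "\<dots> = (\<Sum>k\<in>F. v powr x)" by simp
    also have "\<dots> \<le> (\<Sum>k\<in>F. norm (a k) powr x)"
      using assms x by (intro sum_mono powr_mono2) auto
    also have "\<dots> \<le> V powr x"
      using V(1) ell_norm_le_iff[OF assms(1) False V(2), of a] assms(2) by (simp add: x_def)
    finally show False by simp
  qed
qed

lemma ell_norm_le_of_support:
  assumes "0 < p" "finite F" "F \<noteq> {}" "\<And>k. norm (a k) \<le> v" "\<And>k. k \<notin> F \<Longrightarrow> a k = 0"
  shows "ell_norm p a \<le> ennreal (v * real (card F) powr recip p)"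
proof -
  have v: "0 \<le> v" using assms(4) norm_ge_zero order_trans by blast
  have c: "0 < card F" using assms by (simp add: card_gt_0_iff)
  show ?thesis
  proof (cases "p = \<infinity>")
    case True
    then show ?thesis using assms v c ell_norm_infinity_le_iff[of v a] by simp
  next
    case False
    define x where "x = enn2real p"
    have x: "0 < x" using assms False by (simp add: enn2real_exponent_pos x_def)
    have "(\<Sum>k\<in>G. norm (a k) powr x) \<le> (v * real (card F) powr (1 / x)) powr x" if "finite G" for G
    proof -
      have "(\<Sum>k\<in>G. norm (a k) powr x) = (\<Sum>k\<in>G \<inter> F. norm (a k) powr x)"
        using assms(5) that by (intro sum.mono_neutral_right) auto
      also have "\<dots> \<le> (\<Sum>k\<in>F. norm (a k) powr x)"
        using assms(2) by (intro sum_mono2) auto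
      also have "\<dots> \<le> (\<Sum>k\<in>F. v powr x)"
        using assms x by (intro sum_mono powr_mono2) auto
      also have "\<dots> = (v * real (card F) powr (1 / x)) powr x"
        using x c v by (simp add: powr_mult powr_powr)
      finally show ?thesis .
    qed
    then show ?thesis
      using ell_norm_le_iff[OF assms(1) False, of "v * real (card F) powr (1 / x)" a] v False
      by (simp add: x_def recip_eq)
  qed
qed

lemma ell_norm_mono:
  assumes "0 < p" "\<And>k. norm (a k) \<le> norm (b k)"
  shows "ell_norm p a \<le> ell_norm p b"
proof (cases "ell_norm p b")
  case (real V)
  show ?thesis
  proof (cases "p = \<infinity>")
    case True
    have "\<forall>k. norm (b k) \<le> V"
      using ell_norm_infinity_le_iff[of V b] real True by simp
    then have "\<forall>k. norm (a k) \<le> V" using assms(2) order_trans by blast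
    then show ?thesis using ell_norm_infinity_le_iff[of V a] real True by simp
  next
    case False
    have x: "0 < enn2real p" using assms(1) False by (rule enn2real_exponent_pos)
    have "(\<Sum>k\<in>F. norm (a k) powr enn2real p) \<le> V powr enn2real p" if "finite F" for F
    proof -
      have "(\<Sum>k\<in>F. norm (a k) powr enn2real p) \<le> (\<Sum>k\<in>F. norm (b k) powr enn2real p)"
        using assms(2) x by (intro sum_mono powr_mono2) auto
      also have "\<dots> \<le> V powr enn2real p"
        using ell_norm_le_iff[OF assms(1) False, of V b] real that by simp
      finally show ?thesis .
    qed
    then show ?thesis using ell_norm_le_iff[OF assms(1) False, of V a] real by simp
  qed
qed simp

section \<open>Weighted sequences\<close>

lemma recip_nonneg: "0 \<le> recip p"
  by (simp add: recip_def)

lemma recip_strict_antimono: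
  assumes "0 < p" "p < q"
  shows "recip q < recip p"
proof -
  have "p \<noteq> \<infinity>" using assms(2) by auto
  with assms(1) have p: "0 < enn2real p" "p \<noteq> \<infinity>" by (simp_all add: enn2real_exponent_pos)
  show ?thesis
  proof (cases "q = \<infinity>")
    case False
    have "enn2real p < enn2real q"
      using assms p False by (metis enn2real_less_iff ennreal_enn2real infinity_ennreal_def
          less_top enn2real_nonneg ennreal_less_iff)
    then show ?thesis using p False by (simp add: recip_eq frac_less2)
  qed (use p in \<open>simp add: recip_eq\<close>)
qed

lemma enn2real_mono_exponent: "q \<le> p \<Longrightarrow> p \<noteq> \<infinity> \<Longrightarrow> enn2real q \<le> enn2real p"
  by (simp add: enn2real_mono top.not_eq_extremum)

text \<open>
  Young's inequality without the weights \<open>p/q\<close>, \<open>p/s\<close>: the left-hand side is already bounded by the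
  larger of the two summands.
\<close>

lemma powr_mult_le_add_powr:
  fixes x y :: real
  assumes "0 \<le> x" "0 \<le> y" "0 < q" "0 < s" "1 / p = 1 / q + 1 / s"
  shows "(x * y) powr p \<le> x powr q + y powr s"
proof -
  have main: "(x * y) powr p \<le> x powr q"
    if "0 \<le> x" "0 \<le> y" "0 < q" "0 < s" "1 / p = 1 / q + 1 / s" "y powr s \<le> x powr q"
    for x y q s :: real
  proof -
    have p: "0 < p" using that(3-5)
      by (metis add_pos_pos zero_less_divide_1_iff)
    \<comment> \<open>The assumption gives \<open>y \<le> x powr (q / s)\<close>, so
      \<open>x * y \<le> x powr (1 + q / s)\<close>; the relation between the exponents turns the
      \<open>p\<close>-th power of this into \<open>x powr q\<close>.\<close>
    have "y = (y powr s) powr (1 / s)" using that by (simp add: powr_powr)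
    also have "\<dots> \<le> (x powr q) powr (1 / s)" using that by (intro powr_mono2) auto
    also have "\<dots> = x powr (q / s)" by (simp add: powr_powr)
    finally have "x * y \<le> x * x powr (q / s)" using that by (intro mult_left_mono)
    also have "\<dots> = x powr (1 + q / s)"
      using that by (cases "x = 0") (auto simp: powr_add)
    finally have "(x * y) powr p \<le> (x powr (1 + q / s)) powr p"
      using that p by (intro powr_mono2) auto
    also have "(1 + q / s) * p = q"
    proof -
      have "(1 + q / s) * p = q * (1 / q + 1 / s) * p"
        using that by (simp add: field_simps)
      also have "\<dots> = q" using that(5)[symmetric] p by simp
      finally show ?thesis .
    qed
    then have "(x powr (1 + q / s)) powr p = x powr q" by (simp add: powr_powr)
    finally show ?thesis .
  qed
  show ?thesis
  proof (cases "y powr s \<le> x powr q")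
    case True
    from main[OF assms True] show ?thesis by (smt (verit) powr_ge_zero)
  next
    case False
    then have "(y * x) powr p \<le> y powr s"
      using assms by (intro main[of y x s q]) auto
    then show ?thesis by (smt (verit) powr_ge_zero mult.commute)
  qed
qed

text \<open>The embedding of \<open>\<ell>_q\<close> into \<open>\<ell>_p\<close> with a bounded
  weight: the entries of \<open>b\<close> are at most 1, so passing from \<open>q\<close> to the
  larger exponent \<open>p\<close> only shrinks their powers.\<close>

lemma ell_norm_le_mult:
  assumes "0 < q" "q \<le> p" "ell_norm q b \<le> 1" "0 \<le> V" "\<And>k. norm (a k) \<le> V * norm (b k)"
  shows "ell_norm p a \<le> ennreal V"
proof -
  have b1: "norm (b k) \<le> 1" for k
    using norm_le_of_ell_norm_le[of q 1 b k] assms by simp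
  show ?thesis
  proof (cases "p = \<infinity>")
    case True
    have "norm (a k) \<le> V" for k
      using assms(5)[of k] mult_left_mono[OF b1[of k] assms(4)] by simp
    then show ?thesis using True assms ell_norm_infinity_le_iff by blast
  next
    case False
    then have q: "q \<noteq> \<infinity>" using assms by (auto simp: top_unique)
    define x where "x = enn2real p"
    define y where "y = enn2real q"
    have xy: "0 < y" "y \<le> x"
      using assms q False by (auto simp: x_def y_def enn2real_exponent_pos enn2real_mono_exponent)
    have "(\<Sum>k\<in>F. norm (a k) powr x) \<le> V powr x" if "finite F" for F
    proof -
      have "(\<Sum>k\<in>F. norm (a k) powr x) \<le> (\<Sum>k\<in>F. V powr x * norm (b k) powr y)"
      proof (rule sum_mono)
        fix k
        have "norm (a k) powr x \<le> (V * norm (b k)) powr x"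
          using assms xy by (intro powr_mono2) auto
        also have "\<dots> = V powr x * norm (b k) powr x" using assms by (simp add: powr_mult)
        also have "\<dots> \<le> V powr x * norm (b k) powr y"
          using xy b1 by (intro mult_left_mono powr_mono') auto
        finally show "norm (a k) powr x \<le> V powr x * norm (b k) powr y" .
      qed
      also have "\<dots> = V powr x * (\<Sum>k\<in>F. norm (b k) powr y)" by (simp add: sum_distrib_left)
      also have "\<dots> \<le> V powr x * 1"
        using ell_norm_le_iff[OF assms(1) q, of 1 b] assms that
        by (intro mult_left_mono) (auto simp: y_def)
      finally show ?thesis by simp
    qed
    then show ?thesis using ell_norm_le_iff[of p V a] assms False by (auto simp: x_def)
  qed
qed

text \<open>Hoelder's inequality for \<open>1/p = 1/q + 1/s\<close>. After division of
  \<open>w\<close> by \<open>M\<close>, the Young-type inequality bounds the sum of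
  \<open>p\<close>-th powers by two sums of size at most 1, whence the factor
  \<open>2 powr recip p\<close>.\<close>

lemma ell_norm_le_Holder:
  assumes "0 < p" "p < q" "ell_norm q b \<le> 1" "0 < M"
    and a: "\<And>k. norm (a k) \<le> w k * norm (b k)" and w: "\<And>k. 0 \<le> w k"
    and s: "1 / s = recip p - recip q"
    and M: "\<And>F. finite F \<Longrightarrow> (\<Sum>k\<in>F. w k powr s) \<le> M powr s"
  shows "ell_norm p a \<le> ennreal (2 powr recip p * M)"
proof -
  have b1: "norm (b k) \<le> 1" for k
    using norm_le_of_ell_norm_le[of q 1 b k] assms by simp
  have p: "p \<noteq> \<infinity>" using assms by auto
  have s0: "0 < s"
    using recip_strict_antimono[OF assms(1,2)] s by (metis diff_gt_0_iff_gt zero_less_divide_1_iff)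
  define x where "x = enn2real p"
  have x: "0 < x" "recip p = 1 / x"
    using assms p by (auto simp: x_def enn2real_exponent_pos recip_eq)
  have ws: "(\<Sum>k\<in>F. (w k / M) powr s) \<le> 1" if "finite F" for F
  proof -
    have "(\<Sum>k\<in>F. (w k / M) powr s) = (\<Sum>k\<in>F. w k powr s) / M powr s"
      using w assms(4) by (simp add: powr_divide sum_divide_distrib)
    also have "\<dots> \<le> 1" using M[OF that] assms(4) by (simp add: divide_le_eq)
    finally show ?thesis .
  qed
  have key: "(\<Sum>k\<in>F. (norm (b k) * (w k / M)) powr x) \<le> 2" if F: "finite F" for F
  proof (cases "q = \<infinity>")
    case True
    then have "s = x" using s x by simp
    have "(\<Sum>k\<in>F. (norm (b k) * (w k / M)) powr x) \<le> (\<Sum>k\<in>F. (w k / M) powr x)"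
      using b1 w assms(4) x
      by (intro sum_mono powr_mono2 mult_left_le_one_le mult_nonneg_nonneg divide_nonneg_pos) auto
    also have "\<dots> \<le> 2" using ws[OF F] \<open>s = x\<close> by simp
    finally show ?thesis .
  next
    case False
    define y where "y = enn2real q"
    have y: "0 < y" "recip q = 1 / y"
      using assms False by (auto simp: y_def enn2real_exponent_pos recip_eq)
    have "(\<Sum>k\<in>F. (norm (b k) * (w k / M)) powr x) \<le> (\<Sum>k\<in>F. norm (b k) powr y + (w k / M) powr s)"
      using w assms(4) y s0 s x by (intro sum_mono powr_mult_le_add_powr) (auto simp: divide_nonneg_pos)
    also have "\<dots> = (\<Sum>k\<in>F. norm (b k) powr y) + (\<Sum>k\<in>F. (w k / M) powr s)"
      by (simp add: sum.distrib)
    also have "\<dots> \<le> 1 + 1"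
      using ws[OF F] ell_norm_le_iff[of q 1 b] assms False F by (intro add_mono) (auto simp: y_def)
    finally show ?thesis by simp
  qed
  have "(\<Sum>k\<in>F. norm (a k) powr x) \<le> (2 powr recip p * M) powr x" if F: "finite F" for F
  proof -
    have "(\<Sum>k\<in>F. norm (a k) powr x) \<le> (\<Sum>k\<in>F. M powr x * (norm (b k) * (w k / M)) powr x)"
    proof (rule sum_mono)
      fix k
      have "norm (a k) powr x \<le> (M * (norm (b k) * (w k / M))) powr x"
        using a[of k] x assms(4) by (intro powr_mono2) (auto simp: field_simps)
      also have "\<dots> = M powr x * (norm (b k) * (w k / M)) powr x"
        by (rule powr_mult)
      finally show "norm (a k) powr x \<le> M powr x * (norm (b k) * (w k / M)) powr x" .
    qed
    also have "\<dots> = M powr x * (\<Sum>k\<in>F. (norm (b k) * (w k / M)) powr x)"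
      by (simp add: sum_distrib_left)
    also have "\<dots> \<le> M powr x * 2" using key[OF F] by (intro mult_left_mono) auto
    also have "\<dots> = (2 powr recip p * M) powr x"
      using x assms(4) by (simp add: powr_mult powr_powr)
    finally show ?thesis .
  qed
  then show ?thesis using ell_norm_le_iff[of p "2 powr recip p * M" a] assms p by (auto simp: x_def)
qed

section \<open>Frequency sets of prescribed size and thresholding\<close>

text \<open>The sets in \<open>Gam m\<close> have exactly \<open>m\<close> elements, so smaller sets
  of frequencies have to be padded.\<close>

lemma exists_superset_card:
  assumes "infinite (UNIV :: 'i set)" "finite (A :: 'i set)" "card A \<le> m"
  shows "\<exists>B. A \<subseteq> B \<and> finite B \<and> card B = m"
proof -
  have "infinite (- A)" using assms by (simp add: Compl_eq_Diff_UNIV)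
  then obtain G where G: "finite G" "card G = m - card A" "G \<subseteq> - A"
    using infinite_arbitrarily_large by blast
  then have "card (A \<union> G) = m" using assms card_Un_disjoint[of A G] by auto
  with G assms show ?thesis by (intro exI[of _ "A \<union> G"]) auto
qed

text \<open>
  If \<open>m\<close> coefficients exceeded the threshold \<open>T\<close>, at least \<open>m/2\<close> of them would lie off \<open>Q\<close>, where each
  contributes more than \<open>2/m\<close> to the \<open>\<ell>\<^sub>q\<close> sum of \<open>b\<close>.
\<close>

lemma exists_sparse_ell_norm_le:
  fixes a :: "'i \<Rightarrow> 'a::real_normed_vector" and b :: "'i \<Rightarrow> 'b::real_normed_vector"
  assumes "0 < q" "q < p" "ell_norm q b \<le> 1" "infinite (UNIV :: 'i set)"
    and "finite Q" "2 * card Q \<le> m" "1 \<le> m" "0 < V"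
    and a: "\<And>k. k \<notin> Q \<Longrightarrow> norm (a k) \<le> V * norm (b k)"
  shows "\<exists>\<gamma>. finite \<gamma> \<and> card \<gamma> = m \<and>
    ell_norm p (\<lambda>k. if k \<in> \<gamma> then 0 else a k)
      \<le> ennreal (2 powr recip q * V * real m powr (recip p - recip q))"
proof -
  have q: "q \<noteq> \<infinity>" using assms by auto
  define y where "y = enn2real q"
  have y: "0 < y" "recip q = 1 / y"
    using assms q by (auto simp: y_def enn2real_exponent_pos recip_eq)
  have bsum: "(\<Sum>k\<in>F. norm (b k) powr y) \<le> 1" if "finite F" for F
    using ell_norm_le_iff[of q 1 b] assms q that by (auto simp: y_def)
  define h where "h = real m / 2"
  have h: "0 < h" using assms by (simp add: h_def)
  \<comment> \<open>Chosen so that \<open>T powr y = V powr y / h\<close>: off \<open>Q\<close>, a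
    coefficient above \<open>T\<close> forces \<open>norm (b k) powr y > 1 / h\<close>.\<close>
  define T where "T = V * h powr (- (1 / y))"
  have T: "0 < T" using assms h by (simp add: T_def)
  have Ty: "T powr y = V powr y / h"
    using h y by (simp add: T_def powr_divide powr_powr powr_minus_divide)
  define A where "A = {k. T < norm (a k)}"
  have small: "card G \<noteq> m" if "finite G" "G \<subseteq> A" for G
  proof
    assume G: "card G = m"
    have "h \<le> real (card (G - Q))"
    proof -
      have "m - card Q \<le> card (G - Q)" using diff_card_le_card_Diff[OF assms(5), of G] G by simp
      then have "real m \<le> real (card (G - Q)) + real (card Q)" by linarith
      moreover have "2 * real (card Q) \<le> real m" using assms(6) by linarith
      ultimately show ?thesis unfolding h_def by linarith
    qed
    then have ne: "G - Q \<noteq> {}" using h by (metis card.empty of_nat_0 not_le)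
    have "1 \<le> real (card (G - Q)) * (1 / h)" using \<open>h \<le> _\<close> h by simp
    also have "\<dots> = (\<Sum>k\<in>G - Q. 1 / h)" by simp
    also have "\<dots> < (\<Sum>k\<in>G - Q. norm (b k) powr y)"
    proof (rule sum_strict_mono)
      fix k assume k: "k \<in> G - Q"
      then have "T < V * norm (b k)" using a[of k] that by (auto simp: A_def)
      then have "T powr y < (V * norm (b k)) powr y" using T y by (intro powr_less_mono2) auto
      then have "V powr y * (1 / h) < V powr y * norm (b k) powr y"
        using Ty assms(8) by (simp add: powr_mult)
      then show "1 / h < norm (b k) powr y"
        by (subst (asm) mult_less_cancel_left_pos) (use assms(8) in auto)
    qed (use that ne in auto)
    also have "\<dots> \<le> 1" using bsum that by blast
    finally show False by simp
  qed
  \<comment> \<open>An infinite \<open>A\<close>, or one with more than \<open>m\<close> elements,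
    would have a subset of exactly \<open>m\<close> elements.\<close>
  have finA: "finite A"
    using small infinite_arbitrarily_large[of A m] by metis
  have "card A \<le> m"
    using small obtain_subset_with_card_n[of m A] finA
    by (metis finite_subset linorder_not_le nat_less_le)
  then obtain \<gamma> where \<gamma>: "A \<subseteq> \<gamma>" "finite \<gamma>" "card \<gamma> = m"
    using exists_superset_card[OF assms(4) finA] by blast
  define c where "c = (\<lambda>k. if k \<in> \<gamma> then 0 else a k)"
  have cT: "norm (c k) \<le> T" for k
    using T \<gamma>(1) unfolding c_def A_def by (cases "k \<in> \<gamma>") (auto intro: leI)
  have cb: "norm (c k) \<le> V * norm (b k)" if "k \<notin> Q" for k
    using a[OF that] assms(8) by (auto simp: c_def)
  have "ell_norm p c \<le> ennreal (2 powr recip q * V * real m powr (recip p - recip q))"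
  proof (cases "p = \<infinity>")
    case True
    have "T = 2 powr recip q * V * real m powr (recip p - recip q)"
      using True by (simp add: T_def h_def y(2) powr_divide powr_minus_divide)
    then show ?thesis using ell_norm_infinity_le_iff[of T c] T cT True by simp
  next
    case False
    define x where "x = enn2real p"
    have x: "y \<le> x" "0 < x" "recip p = 1 / x"
      using assms False y(1) by (auto simp: x_def y_def enn2real_mono_exponent recip_eq enn2real_exponent_pos)
    \<comment> \<open>As \<open>m = 2 * h\<close>, the powers of 2 combine to
      \<open>2 powr (1 / x)\<close>, the root of the factor 2 obtained below.\<close>
    have eq: "2 powr recip q * V * real m powr (recip p - recip q) = 2 powr (1 / x) * V * h powr (1 / x - 1 / y)"
      unfolding h_def y(2) x(3) by (simp add: powr_divide powr_diff)
    have "(\<Sum>k\<in>F. norm (c k) powr x) \<le> (2 powr (1 / x) * V * h powr (1 / x - 1 / y)) powr x"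
      if F: "finite F" for F
    proof -
      \<comment> \<open>On \<open>Q\<close> there are at most \<open>h\<close> terms, each at most
        \<open>T powr y\<close>; off \<open>Q\<close> the comparison with \<open>b\<close> applies.
        Each part contributes at most \<open>V powr y\<close>.\<close>
      have "(\<Sum>k\<in>F \<inter> Q. norm (c k) powr y) \<le> (\<Sum>k\<in>F \<inter> Q. T powr y)"
        using cT y by (intro sum_mono powr_mono2) auto
      also have "\<dots> = real (card (F \<inter> Q)) * T powr y" by simp
      also have "\<dots> \<le> h * T powr y"
        using card_mono[OF assms(5), of "F \<inter> Q"] assms(6)
        by (intro mult_right_mono) (auto simp: h_def)
      also have "\<dots> = V powr y" using Ty h by simp
      finally have 1: "(\<Sum>k\<in>F \<inter> Q. norm (c k) powr y) \<le> V powr y" .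
      have "(\<Sum>k\<in>F - Q. norm (c k) powr y) \<le> (\<Sum>k\<in>F - Q. V powr y * norm (b k) powr y)"
      proof (rule sum_mono)
        fix k assume "k \<in> F - Q"
        then have "norm (c k) powr y \<le> (V * norm (b k)) powr y"
          using cb y by (intro powr_mono2) auto
        then show "norm (c k) powr y \<le> V powr y * norm (b k) powr y" by (simp add: powr_mult)
      qed
      also have "\<dots> = V powr y * (\<Sum>k\<in>F - Q. norm (b k) powr y)" by (simp add: sum_distrib_left)
      also have "\<dots> \<le> V powr y * 1" using bsum F by (intro mult_left_mono) auto
      finally have 2: "(\<Sum>k\<in>F - Q. norm (c k) powr y) \<le> V powr y" by simp
      \<comment> \<open>Since the entries are at most \<open>T\<close>, raising the exponent from
        \<open>y\<close> to \<open>x\<close> costs a factor \<open>T powr (x - y)\<close>.\<close>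
      have "(\<Sum>k\<in>F. norm (c k) powr x) \<le> (\<Sum>k\<in>F. T powr (x - y) * norm (c k) powr y)"
      proof (rule sum_mono)
        fix k
        have "norm (c k) powr x = norm (c k) powr (x - y) * norm (c k) powr y"
          by (simp add: powr_add[symmetric])
        also have "\<dots> \<le> T powr (x - y) * norm (c k) powr y"
          using cT x by (intro mult_right_mono powr_mono2) auto
        finally show "norm (c k) powr x \<le> T powr (x - y) * norm (c k) powr y" .
      qed
      also have "\<dots> = T powr (x - y) * (\<Sum>k\<in>F. norm (c k) powr y)" by (simp add: sum_distrib_left)
      also have "\<dots> = T powr (x - y) * ((\<Sum>k\<in>F \<inter> Q. norm (c k) powr y) + (\<Sum>k\<in>F - Q. norm (c k) powr y))"
        using F by (simp add: sum.Int_Diff)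
      also have "\<dots> \<le> T powr (x - y) * (V powr y + V powr y)"
        using 1 2 by (intro mult_left_mono add_mono) auto
      also have "\<dots> = 2 * (V powr (x - y) * V powr y) * h powr (- (1 / y) * (x - y))"
        by (simp add: T_def powr_mult powr_powr)
      also have "V powr (x - y) * V powr y = V powr x" by (simp add: powr_add[symmetric])
      also have "- (1 / y) * (x - y) = (1 / x - 1 / y) * x"
        using x y by (simp add: field_simps)
      also have "2 * V powr x * h powr ((1 / x - 1 / y) * x) = (2 powr (1 / x) * V * h powr (1 / x - 1 / y)) powr x"
        using x by (simp add: powr_mult powr_powr)
      finally show ?thesis .
    qed
    then show ?thesis
      unfolding eq using ell_norm_le_iff[of p _ c] assms False by (auto simp: x_def)
  qed
  then show ?thesis using \<gamma> c_def by blast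
qed

section \<open>Fourier coefficients\<close>

lemma torus_eq_Basis:
  "(torus :: (real ^ 'd::finite) set) = {x. \<forall>b\<in>Basis. x \<bullet> b \<in> {0..<2 * pi}}"
  by (auto simp: torus_def Basis_vec_def inner_axis)

lemma torus_borel [measurable]: "(torus :: (real ^ 'd::finite) set) \<in> sets borel"
  unfolding torus_eq_Basis by measurable

lemma expo_eq_inner: "expo k x = exp (\<i> * of_real ((\<chi> i. of_int (k $ i)) \<bullet> x))"
  by (simp add: expo_def inner_vec_def)

lemma continuous_on_expo: "continuous_on S (expo k)"
  unfolding expo_eq_inner by (intro continuous_intros)

lemma norm_expo [simp]: "norm (expo k x) = 1"
  unfolding expo_eq_inner by (rule norm_exp_i_times)

lemma expo_mult_cnj: "expo k x * cnj (expo j x) = expo (k - j) x"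
  by (simp add: expo_def exp_cnj exp_add[symmetric] algebra_simps sum_subtractf)

lemma expo_periodic: "expo k (x + axis i (2 * pi)) = expo k x"
proof -
  have "(\<Sum>j\<in>UNIV. of_int (k $ j) * (x + axis i (2 * pi)) $ j) =
      (\<Sum>j\<in>UNIV. of_int (k $ j) * x $ j) + (\<Sum>j\<in>UNIV. of_int (k $ j) * axis i (2 * pi) $ j)"
    by (simp add: algebra_simps sum.distrib)
  also have "(\<Sum>j\<in>UNIV. of_int (k $ j) * axis i (2 * pi) $ j) = 2 * pi * of_int (k $ i)"
    by (simp add: axis_def if_distrib sum.delta cong: if_cong)
  finally have "expo k (x + axis i (2 * pi)) =
      expo k x * exp (of_real (2 * pi * of_int (k $ i)) * \<i>)"
    by (simp add: expo_def exp_add[symmetric] algebra_simps)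
  also have "exp (of_real (2 * pi * of_int (k $ i)) * \<i>) = 1"
    using exp_integer_2pi[of "of_int (k $ i)"] by (simp add: mult_ac)
  finally show ?thesis by simp
qed

lemma set_integrable_expo_lborel: "set_integrable lborel torus (expo k)"
proof (rule set_integrable_subset)
  show "set_integrable lborel (cbox 0 (\<chi> i. 2 * pi)) (expo k)"
    unfolding set_integrable_def
    by (rule borel_integrable_compact) (auto intro: continuous_on_expo)
qed (auto simp: torus_def cbox_def inner_axis Basis_vec_def intro: less_imp_le)

lemma set_integrable_expo: "set_integrable lebesgue torus (expo k)"
  using set_integrable_expo_lborel[of k]
  by (simp add: set_integrable_def integrable_completion)

section \<open>Orthogonality of the exponentials\<close>

text \<open>The half-open and the closed period differ by one point. On the closed one an
  antiderivative is explicit for \<open>n \<noteq> 0\<close>, and it has equal values at both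
  ends.\<close>

lemma integral_exp_period:
  "(LINT t|lborel. indicator {0..<2 * pi} t *\<^sub>R exp (\<i> * of_real (of_int n * t)))
    = (if n = 0 then of_real (2 * pi) else 0)"
proof -
  have "(LINT t|lborel. indicator {0..<2 * pi} t *\<^sub>R exp (\<i> * of_real (of_int n * t)))
    = (LINT t|lborel. indicator {0..2 * pi} t *\<^sub>R exp (\<i> * of_real (of_int n * t)))"
  proof (rule integral_cong_AE)
    show "AE t in lborel. indicator {0..<2 * pi} t *\<^sub>R exp (\<i> * of_real (of_int n * t)) =
        (indicator {0..2 * pi} t *\<^sub>R exp (\<i> * of_real (of_int n * t)) :: complex)"
      using AE_lborel_singleton[of "2 * pi"] by eventually_elim (auto simp: indicator_def)
  qed measurable
  also have "\<dots> = (if n = 0 then of_real (2 * pi) else 0)"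
  proof (cases "n = 0")
    case True
    then show ?thesis by (simp add: scaleR_conv_of_real)
  next
    case False
    define F where "F = (\<lambda>t::real. exp (\<i> * of_real (of_int n * t)) / (\<i> * of_int n))"
    have "(LINT t|lborel. indicator {0..2 * pi} t *\<^sub>R exp (\<i> * of_real (of_int n * t))) = F (2 * pi) - F 0"
    proof (rule integral_FTC_Icc)
      fix t
      show "(F has_vector_derivative exp (\<i> * of_real (of_int n * t))) (at t within {0..2 * pi})"
        unfolding F_def of_real_mult
        by (rule has_vector_derivative_real_field[where f = "\<lambda>z. exp (\<i> * (of_real (of_int n) * z)) / (\<i> * of_int n)"])
          (use False in \<open>auto intro!: derivative_eq_intros simp: mult_ac\<close>)
    qed (auto intro!: continuous_intros)
    also have "\<dots> = 0"
      using exp_integer_2pi[of "of_int n"] by (simp add: F_def mult_ac)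
    finally show ?thesis using False by simp
  qed
  finally show ?thesis .
qed

lemma integrable_exp_period:
  "integrable lborel (\<lambda>t. indicator {0..<2 * pi} t *\<^sub>R exp (\<i> * of_real (c * t)))"
proof -
  have "set_integrable lborel {0..2 * pi} (\<lambda>t. exp (\<i> * of_real (c * t)))"
    unfolding set_integrable_def
    by (rule borel_integrable_compact) (auto intro!: continuous_intros)
  then have "set_integrable lborel {0..<2 * pi} (\<lambda>t. exp (\<i> * of_real (c * t)))"
    by (rule set_integrable_subset) auto
  then show ?thesis by (simp add: set_integrable_def)
qed

text \<open>Fubini: the integrand is a product of functions of one coordinate, and the factor of any
  coordinate with \<open>k $ i \<noteq> 0\<close> integrates to 0.\<close>

lemma integral_expo:
  fixes k :: "int ^ 'd::finite"
  shows "(LINT x:torus|lebesgue. expo k x) = (if k = 0 then of_real ((2 * pi) ^ CARD('d)) else 0)"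
proof -
  define v :: "real ^ 'd" where "v = (\<chi> i. of_int (k $ i))"
  define g where "g = (\<lambda>(b::real ^ 'd) t. indicator {0..<2 * pi} t *\<^sub>R exp (\<i> * of_real ((v \<bullet> b) * t)))"
  interpret product_sigma_finite "\<lambda>_::real ^ 'd. lborel :: real measure" ..
  have meas: "(\<lambda>x. indicator torus x *\<^sub>R expo k x) \<in> borel_measurable borel"
    using borel_measurable_continuous_onI[OF continuous_on_expo] by measurable
  have prod: "indicator torus (\<Sum>b\<in>Basis. f b *\<^sub>R b) *\<^sub>R expo k (\<Sum>b\<in>Basis. f b *\<^sub>R b) = (\<Prod>b\<in>Basis. g b (f b))"
    for f :: "real ^ 'd \<Rightarrow> real"
  proof -
    have co: "(\<Sum>b\<in>Basis. f b *\<^sub>R b) \<bullet> b = f b" if "b \<in> Basis" for b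
      using that by (simp add: inner_sum_left_Basis)
    have "indicator torus (\<Sum>b\<in>Basis. f b *\<^sub>R b) = (\<Prod>b\<in>Basis. indicator {0..<2 * pi} (f b) :: real)"
    proof (cases "\<forall>b\<in>(Basis::(real^'d) set). f b \<in> {0..<2 * pi}")
      case True
      then show ?thesis using co by (simp add: torus_eq_Basis)
    next
      case False
      then show ?thesis using co by (auto simp: torus_eq_Basis indicator_def intro!: prod_zero)
    qed
    moreover have "expo k (\<Sum>b\<in>Basis. f b *\<^sub>R b) = (\<Prod>b\<in>Basis. exp (\<i> * of_real ((v \<bullet> b) * f b)))"
      by (simp add: expo_eq_inner v_def[symmetric] inner_sum_right exp_sum sum_distrib_left mult_ac)
    ultimately show ?thesis by (simp add: g_def scaleR_conv_of_real prod.distrib)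
  qed
  have "(LINT x:torus|lebesgue. expo k x) = (LINT x|lborel. indicator torus x *\<^sub>R expo k x)"
    unfolding set_lebesgue_integral_def
    using meas by (intro integral_completion) simp
  \<comment> \<open>\<open>lborel\<close> is the image of the product measure over
    \<open>Basis\<close> under the map from coordinates to vectors.\<close>
  also have "\<dots> = (LINT f|(\<Pi>\<^sub>M b\<in>Basis. lborel). indicator torus (\<Sum>b\<in>Basis. f b *\<^sub>R b) *\<^sub>R expo k (\<Sum>b\<in>Basis. f b *\<^sub>R b))"
    by (subst lborel_eq, rule integral_distr[OF _ meas]) simp
  also have "\<dots> = (LINT f|(\<Pi>\<^sub>M b\<in>Basis. lborel). (\<Prod>b\<in>Basis. g b (f b)))"
    by (simp add: prod)
  also have "\<dots> = (\<Prod>b\<in>Basis. LINT t|lborel. g b t)"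
    by (rule product_integral_prod) (simp_all only: g_def integrable_exp_period finite_Basis)
  also have "\<dots> = (\<Prod>i\<in>UNIV. LINT t|lborel. g (axis i 1) t)"
    by (simp add: Basis_vec_def UNION_singleton_eq_range prod.reindex inj_on_def axis_eq_axis)
  also have "\<dots> = (\<Prod>i\<in>UNIV. if k $ i = 0 then of_real (2 * pi) else 0)"
    using integral_exp_period by (simp add: g_def v_def inner_axis)
  also have "\<dots> = (if k = 0 then of_real ((2 * pi) ^ CARD('d)) else 0)"
    by (auto simp: vec_eq_iff)
  finally show ?thesis .
qed

section \<open>Linearity and trigonometric polynomials\<close>

text \<open>An integrable function times a bounded measurable one. Integrability is what makes the
  coefficients additive in \<open>fourier_diff\<close>, since a non-integrable function has integral
  0 by default.\<close>

lemma set_integrable_mult_cnj_expo: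
  assumes "set_integrable lebesgue torus f"
  shows "set_integrable lebesgue torus (\<lambda>x. f x * cnj (expo k x))"
proof -
  have "(\<lambda>x. cnj (expo k x)) \<in> borel_measurable (lebesgue_on torus)"
  proof (rule continuous_imp_measurable_on_sets_lebesgue)
    show "continuous_on torus (\<lambda>x. cnj (expo k x))"
      by (intro continuous_on_cnj continuous_on_expo)
    show "torus \<in> sets lebesgue"
      by (rule sets_completionI_sets) (simp add: torus_borel)
  qed
  moreover have "bounded ((\<lambda>x. cnj (expo k x)) ` torus)"
    by (rule boundedI[where B = 1]) auto
  moreover have "torus \<in> sets lebesgue"
    by (rule sets_completionI_sets) (simp add: torus_borel)
  ultimately have "(\<lambda>x. cnj (expo k x) * f x) absolutely_integrable_on torus"
    using absolutely_integrable_bounded_measurable_product[OF bilinear_times _ _ _ assms] by blast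
  then show ?thesis by (simp add: mult.commute)
qed

lemma fourier_diff:
  assumes "set_integrable lebesgue torus f" "set_integrable lebesgue torus g"
  shows "fourier (\<lambda>x. f x - g x) j = fourier f j - fourier g j"
  using set_integrable_mult_cnj_expo[OF assms(1), of j] set_integrable_mult_cnj_expo[OF assms(2), of j]
  by (simp add: fourier_def left_diff_distrib set_integral_diff diff_divide_distrib)

lemma set_integrable_trig_poly:
  "set_integrable lebesgue torus (\<lambda>x. \<Sum>k\<in>F. c k * expo k x)"
  unfolding set_integrable_def scaleR_sum_right
  by (intro Bochner_Integration.integrable_sum
      set_integrable_mult_right[OF set_integrable_expo, unfolded set_integrable_def])

lemma fourier_trig_poly:
  assumes "finite F"
  shows "fourier (\<lambda>x. \<Sum>k\<in>F. c k * expo k x) j = (if j \<in> F then c j else 0)"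
proof -
  have "(LINT x:torus|lebesgue. (\<Sum>k\<in>F. c k * expo k x) * cnj (expo j x))
      = (LINT x:torus|lebesgue. (\<Sum>k\<in>F. c k * expo (k - j) x))"
    by (simp add: sum_distrib_right mult.assoc expo_mult_cnj)
  also have "\<dots> = (\<Sum>k\<in>F. LINT x:torus|lebesgue. c k * expo (k - j) x)"
    unfolding set_lebesgue_integral_def scaleR_sum_right
    by (intro Bochner_Integration.integral_sum
        set_integrable_mult_right[OF set_integrable_expo, unfolded set_integrable_def])
  also have "\<dots> = (if j \<in> F then c j * of_real ((2 * pi) ^ CARD('a)) else 0)"
    using assms by (simp add: integral_expo if_distrib sum.delta' cong: if_cong)
  finally show ?thesis by (simp add: fourier_def)
qed

lemma trig_poly_in_L1: "(\<lambda>x. \<Sum>k\<in>F. c k * expo k x) \<in> L1"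
  by (simp add: L1_def set_integrable_trig_poly expo_periodic)

section \<open>The class \<open>B\<close>\<close>

lemma class_B_pos: "\<psi> \<in> class_B \<Longrightarrow> 1 \<le> t \<Longrightarrow> 0 < \<psi> t"
  by (auto simp: class_B_def)

lemma class_B_antimono: "\<psi> \<in> class_B \<Longrightarrow> 1 \<le> x \<Longrightarrow> x \<le> y \<Longrightarrow> \<psi> y \<le> \<psi> x"
  by (auto simp: class_B_def dest!: monotone_onD[of _ _ _ _ x y])

text \<open>The doubling condition is iterated until \<open>2 ^ n\<close> exceeds \<open>A\<close>,
  and monotonicity does the rest: a bounded dilation of the argument costs only a constant.\<close>

lemma class_B_scaling:
  assumes "\<psi> \<in> class_B" "1 \<le> A"
  obtains C where "1 \<le> C" "\<And>t u. 1 \<le> t \<Longrightarrow> 1 \<le> u \<Longrightarrow> u \<le> A * t \<Longrightarrow> \<psi> t \<le> C * \<psi> u"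
proof -
  obtain K where K: "\<And>t. 1 \<le> t \<Longrightarrow> 1 \<le> \<psi> t / \<psi> (2 * t) \<and> \<psi> t / \<psi> (2 * t) \<le> K"
    using assms unfolding class_B_def by blast
  have K1: "1 \<le> K" using K[of 1] by linarith
  have step: "\<psi> t \<le> K * \<psi> (2 * t)" if "1 \<le> t" for t
    using K[OF that] class_B_pos[OF assms(1), of "2 * t"] that by (simp add: divide_le_eq)
  have iter: "\<psi> t \<le> K ^ n * \<psi> (2 ^ n * t)" if t: "1 \<le> t" for t n
  proof (induction n)
    case (Suc n)
    have "1 * 1 \<le> 2 ^ n * t" using t by (intro mult_mono) auto
    then have "\<psi> (2 ^ n * t) \<le> K * \<psi> (2 * (2 ^ n * t))" by (intro step) simp
    then have "K ^ n * \<psi> (2 ^ n * t) \<le> K ^ n * (K * \<psi> (2 * (2 ^ n * t)))"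
      using K1 by (intro mult_left_mono) auto
    with Suc show ?case by (simp add: mult_ac)
  qed simp
  obtain n where n: "A < 2 ^ n" using real_arch_pow[of 2 A] by auto
  show ?thesis
  proof (rule that[of "K ^ n"])
    show "1 \<le> K ^ n" using K1 by simp
    fix t u :: real assume tu: "1 \<le> t" "1 \<le> u" "u \<le> A * t"
    have "A * t \<le> 2 ^ n * t" using n tu by (intro mult_right_mono) auto
    then have "\<psi> (2 ^ n * t) \<le> \<psi> u"
      using tu class_B_antimono[OF assms(1), of u "2 ^ n * t"] by linarith
    then have "K ^ n * \<psi> (2 ^ n * t) \<le> K ^ n * \<psi> u" using K1 by (intro mult_left_mono) auto
    with iter[OF tu(1), of n] show "\<psi> t \<le> K ^ n * \<psi> u" by linarith
  qed
qed

text \<open>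
  The last point of \<open>[a, b]\<close> at which \<open>f x - e (x - a) \<le> f a\<close> must be \<open>b\<close>, for every \<open>e > 0\<close>.
\<close>

lemma right_derivative_nonpos_imp_le:
  fixes f :: "real \<Rightarrow> real"
  assumes "a \<le> b" "continuous_on {a..b} f"
    and "\<And>x. a \<le> x \<Longrightarrow> x < b \<Longrightarrow> \<exists>D\<le>0. (f has_real_derivative D) (at_right x)"
  shows "f b \<le> f a"
proof (rule ccontr)
  assume "\<not> f b \<le> f a"
  then have lt: "f a < f b" and ab: "a < b" using assms(1) by (auto simp: order.strict_iff_order)
  \<comment> \<open>Half the mean slope, so that \<open>f b\<close> still lies strictly above the
    line of slope \<open>e\<close> through \<open>(a, f a)\<close>, whence
    \<open>b \<notin> S\<close>.\<close>
  define e where "e = (f b - f a) / 2 / (b - a)"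
  have e: "0 < e" using lt ab by (simp add: e_def)
  define S where "S = {x \<in> {a..b}. f x - e * (x - a) \<le> f a}"
  have "closed S"
    unfolding S_def using assms(2)
    by (intro continuous_on_closed_Collect_le[of "{a..b}"] continuous_intros) auto
  moreover have "bounded S" by (rule bounded_subset[OF bounded_closed_interval[of a b]]) (auto simp: S_def)
  moreover have "a \<in> S" using assms(1) by (simp add: S_def)
  ultimately obtain c where c: "c \<in> S" "\<And>x. x \<in> S \<Longrightarrow> x \<le> c"
    using compact_attains_sup[of S] by (auto simp: compact_eq_bounded_closed)
  have "e * (b - a) = (f b - f a) / 2"
    using nonzero_divide_eq_eq[of "b - a" "(f b - f a) / 2" e] ab by (simp only: e_def) auto
  then have "b \<notin> S" using lt by (simp add: S_def)
  then have cb: "a \<le> c" "c < b" using c by (auto simp: S_def order.strict_iff_order)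
  obtain D where D: "D \<le> 0" "(f has_real_derivative D) (at_right c)" using assms(3) cb by blast
  \<comment> \<open>The right difference quotient at \<open>c\<close> tends to
    \<open>D \<le> 0 < e\<close>, so \<open>S\<close> contains points to the right of its
    maximum.\<close>
  have "eventually (\<lambda>y. (f y - f c) / (y - c) < e) (at_right c)"
    using D e by (intro order_tendstoD(2)[of _ D]) (auto simp: has_field_derivative_iff)
  moreover have "eventually (\<lambda>y. y \<in> {c<..<b}) (at_right c)"
    by (rule eventually_at_right_real[OF cb(2)])
  ultimately have "eventually (\<lambda>y. (f y - f c) / (y - c) < e \<and> y \<in> {c<..<b}) (at_right c)"
    by eventually_elim simp
  then obtain y where y: "(f y - f c) / (y - c) < e" "c < y" "y < b"
    using eventually_happens'[OF trivial_limit_at_right_real] by fastforce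
  then have "f y - f c < e * (y - c)" by (simp add: divide_less_eq mult.commute)
  then have "y \<in> S" using y c(1) cb by (auto simp: S_def algebra_simps)
  with c(2)[of y] y show False by simp
qed

section \<open>Right derivatives in the class \<open>B\<close> and power decay\<close>

text \<open>The growth condition bounds only the absolute value of the derivative; this supplies the
  sign.\<close>

lemma class_B_right_derivative_nonpos:
  assumes "\<psi> \<in> class_B" "1 \<le> t" "(\<psi> has_real_derivative D) (at_right t)"
  shows "D \<le> 0"
proof (rule tendsto_upperbound)
  show "((\<lambda>y. (\<psi> y - \<psi> t) / (y - t)) \<longlongrightarrow> D) (at_right t)"
    using assms(3) by (simp add: has_field_derivative_iff)
  show "eventually (\<lambda>y. (\<psi> y - \<psi> t) / (y - t) \<le> 0) (at_right t)"
    using eventually_at_right_less[of t]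
  proof eventually_elim
    case (elim y)
    then show ?case using class_B_antimono[OF assms(1,2), of y] by (simp add: divide_nonpos_pos)
  qed
qed simp

text \<open>The condition on the derivative says that \<open>t powr \<beta> * \<psi> t\<close> has
  nonpositive right derivative beyond \<open>t0\<close>, so it is non-increasing there. The constant
  absorbs the bounded range before, where only monotonicity is available.\<close>

lemma class_B_power_decay:
  assumes B: "\<psi> \<in> class_B" and t0: "1 \<le> t0" and \<beta>: "0 \<le> \<beta>" and cvx: "convex_on {t0<..} \<psi>"
    and der: "\<And>t. t0 < t \<Longrightarrow> \<exists>D. (\<psi> has_real_derivative D) (at_right t) \<and> \<beta> \<le> t * \<bar>D\<bar> / \<psi> t"
  obtains C where "1 \<le> C" "\<And>x y. 1 \<le> x \<Longrightarrow> x \<le> y \<Longrightarrow> \<psi> y \<le> C * \<psi> x * (x / y) powr \<beta>"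
proof -
  \<comment> \<open>Right derivatives alone leave left limits uncontrolled; convexity on an open
    half-line provides the continuity that \<open>right_derivative_nonpos_imp_le\<close>
    requires.\<close>
  have cont: "continuous_on {t0<..} \<psi>"
    by (rule convex_on_continuous) (use cvx in auto)
  have mono: "\<psi> y * y powr \<beta> \<le> \<psi> x * x powr \<beta>" if xy: "t0 < x" "x \<le> y" for x y
  proof (rule right_derivative_nonpos_imp_le[of x y "\<lambda>t. \<psi> t * t powr \<beta>"])
    show "continuous_on {x..y} (\<lambda>t. \<psi> t * t powr \<beta>)"
      using xy t0 by (intro continuous_intros continuous_on_subset[OF cont]) auto
    fix t assume t: "x \<le> t" "t < y"
    then have tp: "0 < t" "1 \<le> t" "t0 < t" using xy t0 by auto
    obtain D where D: "(\<psi> has_real_derivative D) (at_right t)" "\<beta> \<le> t * \<bar>D\<bar> / \<psi> t"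
      using der[OF tp(3)] by blast
    have "D \<le> 0" by (rule class_B_right_derivative_nonpos[OF B tp(2) D(1)])
    moreover have "\<beta> * \<psi> t \<le> t * \<bar>D\<bar>"
      using D(2) class_B_pos[OF B tp(2)] by (simp only: pos_le_divide_eq)
    ultimately have le: "\<beta> * \<psi> t + t * D \<le> 0" by simp
    have "((\<lambda>t. \<psi> t * t powr \<beta>) has_real_derivative (D * t powr \<beta> + \<beta> * t powr (\<beta> - 1) * \<psi> t)) (at_right t)"
      using DERIV_mult[OF D(1) has_field_derivative_at_within[OF has_real_derivative_powr[OF tp(1), of \<beta>]]]
      by simp
    moreover have "D * t powr \<beta> + \<beta> * t powr (\<beta> - 1) * \<psi> t = t powr (\<beta> - 1) * (\<beta> * \<psi> t + t * D)"
      using tp by (simp add: powr_diff field_simps)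
    moreover have "\<dots> \<le> 0" using le by (simp add: mult_nonneg_nonpos)
    ultimately show "\<exists>D\<le>0. ((\<lambda>t. \<psi> t * t powr \<beta>) has_real_derivative D) (at_right t)" by metis
  qed (use xy in auto)
  define t1 where "t1 = t0 + 1"
  have t1: "t0 < t1" "1 \<le> t1" using t0 by (auto simp: t1_def)
  have C1: "1 \<le> t1 powr \<beta>" using t1 \<beta> by (simp add: ge_one_powr_ge_zero)
  have le: "\<psi> y \<le> \<psi> x * (x / y) powr \<beta>" if "t0 < x" "x \<le> y" for x y
    using mono[OF that] that t0 by (simp add: powr_divide field_simps)
  show ?thesis
  proof (rule that[OF C1])
    fix x y :: real assume xy: "1 \<le> x" "x \<le> y"
    have p: "0 < \<psi> x" by (rule class_B_pos[OF B xy(1)])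
    \<comment> \<open>If both points are at most \<open>t1\<close>, then
      \<open>x / y \<ge> 1 / t1\<close> and monotonicity suffices; if \<open>t1\<close> separates
      them, the decay starts at \<open>t1\<close>.\<close>
    consider "t0 < x" | "x \<le> t1" "y \<le> t1" | "x \<le> t1" "t1 \<le> y" using t1 by linarith
    then show "\<psi> y \<le> t1 powr \<beta> * \<psi> x * (x / y) powr \<beta>"
    proof cases
      case 1
      have "1 * (\<psi> x * (x / y) powr \<beta>) \<le> t1 powr \<beta> * (\<psi> x * (x / y) powr \<beta>)"
        using C1 p by (intro mult_right_mono) auto
      with le[OF 1 xy(2)] show ?thesis by (simp add: mult.assoc)
    next
      case 2
      have "1 powr \<beta> \<le> (t1 * (x / y)) powr \<beta>"
        using xy 2 \<beta> t1 mult_mono[of y t1 1 x] by (intro powr_mono2) (auto simp: field_simps)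
      then have "\<psi> x * 1 \<le> \<psi> x * (t1 powr \<beta> * (x / y) powr \<beta>)"
        using p by (intro mult_left_mono) (auto simp: powr_mult powr_divide)
      moreover have "\<psi> y \<le> \<psi> x" by (rule class_B_antimono[OF B xy])
      ultimately show ?thesis by (simp add: mult_ac)
    next
      case 3
      have "\<psi> y \<le> \<psi> t1 * (t1 / y) powr \<beta>" by (rule le[OF t1(1) 3(2)])
      also have "\<dots> \<le> \<psi> x * (t1 * x / y) powr \<beta>"
        using xy 3 t1 \<beta> p class_B_antimono[OF B xy(1) 3(1)]
        by (intro mult_mono powr_mono2 divide_right_mono) auto
      also have "\<dots> = t1 powr \<beta> * \<psi> x * (x / y) powr \<beta>"
        by (simp add: powr_mult powr_divide)
      finally show ?thesis .
    qed
  qed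
qed

section \<open>Cubes and weights\<close>

text \<open>The sup norm is strictly less than \<open>n\<close>, so \<open>cube 0\<close> is empty and \<open>cube 1 = {0}\<close>.\<close>

definition cube :: "nat \<Rightarrow> (int ^ 'd::finite) set" where
  "cube n = {k. \<forall>i. \<bar>k $ i\<bar> < int n}"

section \<open>Counting the points of cubes\<close>

lemma bij_betw_vec_nth_cube:
  "bij_betw vec_nth (cube n :: (int ^ 'd::finite) set) (PiE UNIV (\<lambda>_. {- int n<..<int n}))"
proof -
  have "\<bar>x\<bar> < int n \<longleftrightarrow> x \<in> {- int n<..<int n}" for x by auto
  then show ?thesis
    unfolding cube_def by (intro bij_betwI[where g = vec_lambda]) (auto simp: PiE_UNIV_domain)
qed

text \<open>Truncated subtraction is right at \<open>n = 0\<close>: the cube is empty, and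
  \<open>0 ^ CARD('d) = 0\<close>.\<close>

lemma card_cube: "card (cube n :: (int ^ 'd::finite) set) = (2 * n - 1) ^ CARD('d)"
  using bij_betw_same_card[OF bij_betw_vec_nth_cube[where 'd = 'd and n = n]]
  by (simp add: card_PiE nat_diff_distrib' nat_mult_distrib flip: mult_2)

lemma finite_cube [simp]: "finite (cube n :: (int ^ 'd::finite) set)"
  using bij_betw_finite[OF bij_betw_vec_nth_cube[where 'd = 'd and n = n]]
  by (simp add: finite_PiE)

lemma cube_mono: "n \<le> n' \<Longrightarrow> cube n \<subseteq> cube n'"
  by (auto simp: cube_def intro: order.strict_trans2)

lemma infinite_UNIV_int_vec: "infinite (UNIV :: (int ^ 'd::finite) set)"
proof -
  have "inj (vec :: int \<Rightarrow> int ^ 'd)" by (auto simp: inj_on_def vec_eq_iff)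
  then show ?thesis
    using finite_imageD[of vec "UNIV :: int set"] finite_subset[OF subset_UNIV] infinite_UNIV_int
    by blast
qed

lemma finite_subset_cube:
  assumes "finite (F :: (int ^ 'd::finite) set)"
  obtains n where "F \<subseteq> cube n"
proof
  define n where "n = nat ((\<Sum>k\<in>F. \<Sum>i\<in>UNIV. \<bar>k $ i\<bar>) + 1)"
  show "F \<subseteq> cube n"
  proof
    fix k assume k: "k \<in> F"
    have "\<bar>k $ i\<bar> \<le> (\<Sum>k\<in>F. \<Sum>i\<in>UNIV. \<bar>k $ i\<bar>)" for i
    proof -
      have "\<bar>k $ i\<bar> \<le> (\<Sum>i\<in>UNIV. \<bar>k $ i\<bar>)" by (rule member_le_sum) auto
      also have "\<dots> \<le> (\<Sum>k\<in>F. \<Sum>i\<in>UNIV. \<bar>k $ i\<bar>)"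
        by (rule member_le_sum[OF k, of "\<lambda>k. \<Sum>i\<in>UNIV. \<bar>k $ i\<bar>"]) (use assms in \<open>auto simp: sum_nonneg\<close>)
      finally show ?thesis .
    qed
    then show "k \<in> cube n" by (auto simp: cube_def n_def sum_nonneg)
  qed
qed

section \<open>Weights inside and outside a cube\<close>

lemma ell_norm_int_vec:
  fixes k :: "int ^ 'd::finite"
  assumes "0 < r"
  defines "R \<equiv> enn2real (ell_norm r (\<lambda>i. real_of_int (k $ i)))"
  shows "\<bar>real_of_int (k $ i)\<bar> \<le> R"
    and "k \<in> cube n \<Longrightarrow> R \<le> real n * real CARD('d) powr recip r"
proof -
  have bd: "ell_norm r (\<lambda>i. real_of_int (k $ i)) \<le> ennreal (v * real CARD('d) powr recip r)"
    if "\<And>i. \<bar>real_of_int (k $ i)\<bar> \<le> v" for v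
    by (rule ell_norm_le_of_support[of r UNIV]) (use assms that in auto)
  \<comment> \<open>Some finite bound has to come first, because \<open>enn2real\<close> would turn
    an infinite norm into 0.\<close>
  have "\<bar>real_of_int (k $ i)\<bar> \<le> (\<Sum>i\<in>UNIV. \<bar>real_of_int (k $ i)\<bar>)" for i
    by (rule member_le_sum) auto
  from le_less_trans[OF bd[OF this] ennreal_less_top]
  have "ell_norm r (\<lambda>i. real_of_int (k $ i)) < top" .
  then have R: "ell_norm r (\<lambda>i. real_of_int (k $ i)) = ennreal R" by (simp add: R_def)
  show "\<bar>real_of_int (k $ i)\<bar> \<le> R"
    using norm_le_of_ell_norm_le[OF assms(1) _ eq_refl[OF R], of i] enn2real_nonneg
    unfolding R_def by simp
  assume "k \<in> cube n"
  then have "\<bar>k $ i\<bar> \<le> int n" for i by (simp add: cube_def less_imp_le)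
  then have "\<bar>real_of_int (k $ i)\<bar> \<le> real n" for i
    by (metis of_int_abs of_int_le_iff of_int_of_nat_eq)
  from bd[OF this] show "R \<le> real n * real CARD('d) powr recip r"
    unfolding R by (subst (asm) ennreal_le_iff) auto
qed

lemma ell_norm_int_vec_ge_1:
  fixes k :: "int ^ 'd::finite"
  assumes "0 < r" "k \<noteq> 0"
  shows "1 \<le> enn2real (ell_norm r (\<lambda>i. real_of_int (k $ i)))"
proof -
  obtain i where "k $ i \<noteq> 0" using assms(2) by (auto simp: vec_eq_iff)
  then have "1 \<le> \<bar>k $ i\<bar>" by linarith
  then have "1 \<le> \<bar>real_of_int (k $ i)\<bar>" by linarith
  with ell_norm_int_vec(1)[OF assms(1), of k i] show ?thesis by linarith
qed

context
  fixes \<psi> :: "real \<Rightarrow> real" and r :: ennreal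
  assumes B: "\<psi> \<in> class_B" and r: "0 < r"
begin

lemma Psi_pos: "0 < Psi \<psi> r k"
  by (simp add: Psi_def class_B_pos[OF B] ell_norm_int_vec_ge_1[OF r])

text \<open>The maximum with 1 covers the empty cube, whose complement contains 0: the argument
  stays in the domain of \<open>\<psi>\<close>, and \<open>\<psi> 1\<close> is the weight at
  0.\<close>

lemma Psi_le_of_notin_cube:
  fixes k :: "int ^ 'd::finite"
  assumes "k \<notin> cube n"
  shows "Psi \<psi> r k \<le> \<psi> (real (max 1 n))"
proof (cases "k = 0")
  case True
  then have "n = 0" using assms by (auto simp: cube_def)
  then show ?thesis using True by (simp add: Psi_def)
next
  case False
  obtain i where "int n \<le> \<bar>k $ i\<bar>" using assms by (auto simp: cube_def not_less)
  then have "real n \<le> \<bar>real_of_int (k $ i)\<bar>" by linarith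
  then have "real (max 1 n) \<le> enn2real (ell_norm r (\<lambda>i. real_of_int (k $ i)))"
    using ell_norm_int_vec(1)[OF r, of k i] ell_norm_int_vec_ge_1[OF r False] by simp
  then show ?thesis using False by (simp add: Psi_def class_B_antimono[OF B])
qed

lemma Psi_ge_of_in_cube:
  fixes k :: "int ^ 'd::finite"
  assumes "k \<in> cube n" "1 \<le> n"
  shows "\<psi> (real n * real CARD('d) powr recip r) \<le> Psi \<psi> r k"
proof (cases "k = 0")
  case True
  have "1 * 1 \<le> real n * real CARD('d) powr recip r"
    using assms by (intro mult_mono ge_one_powr_ge_zero) (auto simp: recip_def Suc_leI)
  then show ?thesis using True by (simp add: Psi_def class_B_antimono[OF B])
next
  case False
  then show ?thesis
    using ell_norm_int_vec(2)[OF r assms(1)] ell_norm_int_vec_ge_1[OF r False]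
    by (simp add: Psi_def class_B_antimono[OF B])
qed

end

section \<open>Cubes adapted to \<open>m\<close>\<close>

text \<open>With \<open>L ^ CARD('d) = m\<close> the side \<open>2 * n - 1\<close> is at most
  \<open>L / 2\<close>, so there are at most \<open>m / 2 ^ CARD('d)\<close> points. For
  \<open>L < 4\<close> the cube is empty, as \<open>m = 1\<close> demands.\<close>

lemma two_card_cube_le:
  assumes "1 \<le> m" and n: "n = nat \<lfloor>real m powr (1 / real CARD('d)) / 4\<rfloor>"
  shows "2 * card (cube n :: (int ^ 'd::finite) set) \<le> m"
proof (cases "n = 0")
  case True
  then show ?thesis by (simp add: card_cube zero_power)
next
  case False
  define L where "L = real m powr (1 / real CARD('d))"
  have L: "L ^ CARD('d) = real m" "0 \<le> L"
    using assms(1) by (auto simp: L_def powr_realpow[symmetric] powr_powr)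
  have "real n \<le> L / 4" using n[folded L_def] L(2) by linarith
  then have "real (2 * n - 1) ^ CARD('d) \<le> (L / 2) ^ CARD('d)"
    using False by (intro power_mono) (auto simp: of_nat_diff)
  also have "\<dots> = real m / 2 ^ CARD('d)" by (simp add: power_divide L)
  also have "\<dots> \<le> real m / 2 ^ 1"
    by (intro divide_left_mono power_increasing) (auto simp: Suc_leI)
  finally have "real (2 * card (cube n :: (int ^ 'd) set)) \<le> real m"
    by (simp add: card_cube)
  then show ?thesis by (simp only: of_nat_le_iff)
qed

text \<open>The added 1 makes the side \<open>2 * n - 1\<close> at least \<open>2 * L\<close>, and
  \<open>(2 * L) ^ CARD('d) = 2 ^ CARD('d) * m \<ge> 2 * m\<close>.\<close>

lemma two_mult_le_card_cube:
  assumes "1 \<le> m" and n: "n = nat \<lceil>real m powr (1 / real CARD('d))\<rceil> + 1"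
  shows "2 * m \<le> card (cube n :: (int ^ 'd::finite) set)"
proof -
  define L where "L = real m powr (1 / real CARD('d))"
  have L: "L ^ CARD('d) = real m" "0 \<le> L"
    using assms(1) by (auto simp: L_def powr_realpow[symmetric] powr_powr)
  have "real (2 * n - 1) = 2 * real (nat \<lceil>L\<rceil>) + 1" by (simp add: n L_def)
  moreover have "L \<le> real (nat \<lceil>L\<rceil>)" by linarith
  ultimately have nL: "2 * L \<le> real (2 * n - 1)" by linarith
  have "real m * 2 ^ 1 \<le> real m * 2 ^ CARD('d)"
    by (intro mult_left_mono power_increasing) (auto simp: Suc_leI)
  also have "\<dots> = (2 * L) ^ CARD('d)" by (simp add: power_mult_distrib L)
  also have "\<dots> \<le> real (2 * n - 1) ^ CARD('d)"
    using nL L by (intro power_mono) auto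
  finally have "real (2 * m) \<le> real (card (cube n :: (int ^ 'd) set))"
    by (simp add: card_cube)
  then show ?thesis by (simp only: of_nat_le_iff)
qed

lemma root_ge_1: "1 \<le> m \<Longrightarrow> 1 \<le> real m powr (1 / real n)"
  by (rule ge_one_powr_ge_zero) auto

text \<open>For \<open>x < 8\<close> the 1 suffices; otherwise the floor is at least
  \<open>x / 4 - 1 \<ge> x / 8\<close>. This is the dilation factor between
  \<open>m powr (1 / CARD('d))\<close> and the size of the small cube.\<close>

lemma le_8_max_floor: "x \<le> 8 * real (max 1 (nat \<lfloor>x / 4\<rfloor>))"
  by linarith

section \<open>Weights at the scale of \<open>m\<close>\<close>

context
  fixes \<psi> :: "real \<Rightarrow> real" and r :: ennreal
  assumes B: "\<psi> \<in> class_B" and r: "0 < r"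
begin

lemma Psi_upper:
  obtains C where "0 < C" "\<And>m. 1 \<le> m \<Longrightarrow> \<exists>Q :: (int ^ 'd::finite) set. finite Q \<and> 2 * card Q \<le> m \<and>
    (\<forall>k. k \<notin> Q \<longrightarrow> Psi \<psi> r k \<le> C * \<psi> (real m powr (1 / real CARD('d))))"
proof -
  obtain C where C: "1 \<le> C" "\<And>t u. 1 \<le> t \<Longrightarrow> 1 \<le> u \<Longrightarrow> u \<le> 8 * t \<Longrightarrow> \<psi> t \<le> C * \<psi> u"
    using class_B_scaling[OF B, of 8] by auto
  show ?thesis
  proof (rule that[of C])
    fix m :: nat assume m: "1 \<le> m"
    define L where "L = real m powr (1 / real CARD('d))"
    define n where "n = nat \<lfloor>L / 4\<rfloor>"
    have "Psi \<psi> r k \<le> C * \<psi> L" if "k \<notin> cube n" for k :: "int ^ 'd"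
    proof -
      have "\<psi> (real (max 1 n)) \<le> C * \<psi> L"
        using le_8_max_floor[of L] root_ge_1[OF m] by (intro C(2)) (auto simp: n_def L_def)
      with Psi_le_of_notin_cube[OF B r that] show ?thesis by linarith
    qed
    then show "\<exists>Q :: (int ^ 'd) set. finite Q \<and> 2 * card Q \<le> m \<and>
        (\<forall>k. k \<notin> Q \<longrightarrow> Psi \<psi> r k \<le> C * \<psi> (real m powr (1 / real CARD('d))))"
      using two_card_cube_le[OF m n_def[unfolded L_def]] by (auto simp: L_def intro!: exI[of _ "cube n"])
  qed (use C in simp)
qed

text \<open>The set has \<open>2 * m\<close> points so that every \<open>m\<close> frequencies miss
  at least \<open>m\<close> of them.\<close>

lemma Psi_lower:
  obtains c where "0 < c" "\<And>m. 1 \<le> m \<Longrightarrow> \<exists>P :: (int ^ 'd::finite) set. finite P \<and> card P = 2 * m \<and>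
    (\<forall>k\<in>P. c * \<psi> (real m powr (1 / real CARD('d))) \<le> Psi \<psi> r k)"
proof -
  \<comment> \<open>\<open>n = \<lceil>L\<rceil> + 1 \<le> 3 * L\<close> since
    \<open>L \<ge> 1\<close>, and on the cube \<open>|k|_r\<close> is at most \<open>n\<close> times
    the power of \<open>CARD('d)\<close>.\<close>
  define A where "A = 3 * real CARD('d) powr recip r"
  have D: "1 \<le> real CARD('d) powr recip r"
    by (intro ge_one_powr_ge_zero) (auto simp: recip_def Suc_leI)
  obtain C where C: "1 \<le> C" "\<And>t u. 1 \<le> t \<Longrightarrow> 1 \<le> u \<Longrightarrow> u \<le> A * t \<Longrightarrow> \<psi> t \<le> C * \<psi> u"
    using class_B_scaling[OF B, of A] D by (auto simp: A_def)
  show ?thesis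
  proof (rule that[of "1 / C"])
    fix m :: nat assume m: "1 \<le> m"
    define L where "L = real m powr (1 / real CARD('d))"
    have L: "1 \<le> L" using root_ge_1[OF m] by (simp add: L_def)
    define n where "n = nat \<lceil>L\<rceil> + 1"
    have n: "1 \<le> real n" "real n \<le> 3 * L" "1 \<le> n" using L unfolding n_def by linarith+
    have "1 / C * \<psi> L \<le> Psi \<psi> r k" if "k \<in> cube n" for k :: "int ^ 'd"
    proof -
      have "real n * real CARD('d) powr recip r \<le> 3 * L * real CARD('d) powr recip r"
        using n by (intro mult_right_mono) auto
      moreover have "1 * 1 \<le> real n * real CARD('d) powr recip r"
        using n D by (intro mult_mono) auto
      ultimately have "\<psi> L \<le> C * \<psi> (real n * real CARD('d) powr recip r)"
        using L by (intro C(2)) (auto simp: A_def)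
      also have "\<dots> \<le> C * Psi \<psi> r k"
        using C(1) Psi_ge_of_in_cube[OF B r that n(3)] by (intro mult_left_mono) auto
      finally show ?thesis using C(1) by (simp add: divide_le_eq mult.commute)
    qed
    moreover obtain P :: "(int ^ 'd) set" where "P \<subseteq> cube n" "card P = 2 * m" "finite P"
      using obtain_subset_with_card_n[OF two_mult_le_card_cube[OF m n_def[unfolded L_def]]] by blast
    ultimately show "\<exists>P :: (int ^ 'd) set. finite P \<and> card P = 2 * m \<and>
        (\<forall>k\<in>P. 1 / C * \<psi> (real m powr (1 / real CARD('d))) \<le> Psi \<psi> r k)"
      unfolding L_def by (intro exI[of _ P]) blast
  qed (use C in simp)
qed

text \<open>Sort the points by the least \<open>j\<close> with
  \<open>k \<in> cube (2 ^ j * M)\<close>. The decay gives the \<open>s\<close>-th power of the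
  weight a factor \<open>2 powr (- j * \<beta> * s)\<close> up to a constant, the cube has at most
  \<open>(2 ^ (j + 1) * M) ^ CARD('d)\<close> points, and the product is geometric of ratio
  \<open>2 powr (CARD('d) - \<beta> * s) < 1\<close>.\<close>

lemma Psi_dyadic_tail:
  fixes F :: "(int ^ 'd::finite) set"
  assumes C: "1 \<le> C" "\<And>x y. 1 \<le> x \<Longrightarrow> x \<le> y \<Longrightarrow> \<psi> y \<le> C * \<psi> x * (x / y) powr \<beta>"
    and s: "0 < s" "real CARD('d) < \<beta> * s" and F: "finite F" "F \<inter> cube n = {}"
    and M: "M = max 1 n"
  shows "(\<Sum>k\<in>F. Psi \<psi> r k powr s) \<le>
    (2 powr (\<beta> * s) * 2 ^ CARD('d) / (1 - 2 powr (real CARD('d) - \<beta> * s)))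
      * (C * \<psi> (real M)) powr s * real M ^ CARD('d)"
proof -
  define d where "d = CARD('d)"
  have M1: "1 \<le> M" using M by simp
  define V where "V = (C * \<psi> (real M)) powr s"
  have V: "0 \<le> V" by (simp add: V_def)
  have psiM: "0 < \<psi> (real M)" using M1 by (intro class_B_pos[OF B]) simp
  define z where "z = 2 powr (real d - \<beta> * s)"
  have z: "0 < z" "z < 1" using s powr_less_mono[of "real d - \<beta> * s" 0 2] by (auto simp: z_def d_def)
  obtain J where J: "F \<subseteq> cube J" using finite_subset_cube[OF F(1)] .
  have J': "F \<subseteq> cube (2 ^ J * M)"
  proof -
    have "J * 1 \<le> 2 ^ J * M" using M1 by (intro mult_mono less_imp_le[OF less_exp]) auto
    then show ?thesis using J cube_mono[of J "2 ^ J * M"] by auto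
  qed
  \<comment> \<open>Each point is charged for every cube that contains it, not just for its shell;
    this only enlarges the sum and reduces it to cardinalities of cubes. The factor
    \<open>2 powr (\<beta> * s)\<close> pays for the shift from \<open>j\<close> to
    \<open>j - 1\<close> below.\<close>
  define h where "h = (\<lambda>(k :: int ^ 'd) j. if k \<in> cube (2 ^ j * M) then V * 2 powr (\<beta> * s) * 2 powr (- (real j * \<beta> * s)) else 0)"
  have h0: "0 \<le> h k j" for k :: "int ^ 'd" and j using V by (simp add: h_def)
  have pt: "Psi \<psi> r k powr s \<le> (\<Sum>j\<le>J. h k j)" if k: "k \<in> F" for k
  proof -
    define j where "j = (LEAST j. k \<in> cube (2 ^ j * M))"
    have kJ: "k \<in> cube (2 ^ J * M)" using J' k by auto
    have kj: "k \<in> cube (2 ^ j * M)" unfolding j_def by (rule LeastI[of "\<lambda>j. k \<in> cube (2 ^ j * M)", OF kJ])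
    have jJ: "j \<le> J" unfolding j_def by (rule Least_le[of "\<lambda>j. k \<in> cube (2 ^ j * M)", OF kJ])
    have "Psi \<psi> r k powr s \<le> V * 2 powr (\<beta> * s) * 2 powr (- (real j * \<beta> * s))"
    proof (cases j)
      case 0
      \<comment> \<open>Within the first cube the exclusion of \<open>cube n\<close> leaves just 0
        when \<open>n = 0\<close>, and nothing otherwise.\<close>
      have "k \<notin> cube n" using k F by auto
      then have "Psi \<psi> r k \<le> \<psi> (real M)" unfolding M by (rule Psi_le_of_notin_cube[OF B r])
      also have "\<dots> \<le> C * \<psi> (real M)" using C(1) psiM by simp
      finally have "Psi \<psi> r k powr s \<le> V"
        unfolding V_def using s Psi_pos[OF B r, of k] by (intro powr_mono2) auto
      also have "\<dots> \<le> V * 2 powr (\<beta> * s)"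
        using V s ge_one_powr_ge_zero[of 2 "\<beta> * s"] by (intro mult_le_cancel_left1[THEN iffD2]) auto
      finally show ?thesis using 0 by simp
    next
      case (Suc i)
      \<comment> \<open>Minimality puts \<open>k\<close> outside the previous cube, so the decay
        from \<open>M\<close> to \<open>2 ^ i * M\<close> applies.\<close>
      then have ki: "k \<notin> cube (2 ^ i * M)"
        using not_less_Least[of i "\<lambda>j. k \<in> cube (2 ^ j * M)"] by (simp add: j_def)
      have "1 * 1 \<le> 2 ^ i * M" using M1 by (intro mult_mono) auto
      then have "Psi \<psi> r k \<le> \<psi> (real (2 ^ i * M))"
        using Psi_le_of_notin_cube[OF B r ki] by (simp add: max_def)
      also have "\<dots> \<le> C * \<psi> (real M) * (real M / real (2 ^ i * M)) powr \<beta>"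
        using M1 by (intro C(2)) auto
      also have "real M / real (2 ^ i * M) = 2 powr (- real i)"
        using M1 by (simp add: powr_minus_divide powr_realpow)
      finally have "Psi \<psi> r k powr s \<le> (C * \<psi> (real M) * (2 powr (- real i)) powr \<beta>) powr s"
        using s Psi_pos[OF B r, of k] by (intro powr_mono2) auto
      also have "\<dots> = V * 2 powr (- (real i * \<beta> * s))"
        by (simp add: V_def powr_mult powr_powr)
      also have "2 powr (- (real i * \<beta> * s)) = 2 powr (\<beta> * s) * 2 powr (- (real j * \<beta> * s))"
        by (simp add: Suc powr_add[symmetric] algebra_simps)
      finally show ?thesis by (simp add: mult.assoc)
    qed
    also have "\<dots> = h k j" using kj by (simp add: h_def)
    also have "\<dots> \<le> (\<Sum>j\<le>J. h k j)" using jJ h0 by (intro member_le_sum) auto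
    finally show ?thesis .
  qed
  have "(\<Sum>k\<in>F. Psi \<psi> r k powr s) \<le> (\<Sum>k\<in>F. \<Sum>j\<le>J. h k j)" by (rule sum_mono[OF pt])
  also have "\<dots> = (\<Sum>j\<le>J. \<Sum>k\<in>F. h k j)" by (rule sum.swap)
  also have "\<dots> \<le> (\<Sum>j\<le>J. V * 2 powr (\<beta> * s) * (2 ^ d * real M ^ d) * z ^ j)"
  proof (rule sum_mono)
    fix j
    have "(\<Sum>k\<in>F. h k j) = (\<Sum>k\<in>F \<inter> cube (2 ^ j * M). V * 2 powr (\<beta> * s) * 2 powr (- (real j * \<beta> * s)))"
      unfolding h_def by (rule sum.inter_restrict[OF F(1), symmetric])
    also have "\<dots> = real (card (F \<inter> cube (2 ^ j * M))) * (V * 2 powr (\<beta> * s) * 2 powr (- (real j * \<beta> * s)))"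
      by simp
    also have "\<dots> \<le> (2 * (2 ^ j * real M)) ^ d * (V * 2 powr (\<beta> * s) * 2 powr (- (real j * \<beta> * s)))"
    proof (rule mult_right_mono)
      have "card (F \<inter> cube (2 ^ j * M)) \<le> card (cube (2 ^ j * M) :: (int ^ 'd) set)"
        by (rule card_mono) auto
      also have "\<dots> \<le> (2 * (2 ^ j * M)) ^ d"
        unfolding card_cube d_def by (rule power_mono) auto
      finally have "real (card (F \<inter> cube (2 ^ j * M))) \<le> real ((2 * (2 ^ j * M)) ^ d)"
        by (simp only: of_nat_le_iff)
      then show "real (card (F \<inter> cube (2 ^ j * M))) \<le> (2 * (2 ^ j * real M)) ^ d" by simp
    qed (use V in simp)
    also have "\<dots> = V * 2 powr (\<beta> * s) * (2 ^ d * real M ^ d) * ((2 ^ j) ^ d * 2 powr (- (real j * \<beta> * s)))"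
      by (simp add: power_mult_distrib)
    also have "(2 ^ j) ^ d * 2 powr (- (real j * \<beta> * s)) = z ^ j"
    proof -
      have "z ^ j = 2 powr ((real d - \<beta> * s) * real j)"
        by (simp add: z_def powr_realpow[symmetric] powr_powr)
      also have "\<dots> = 2 powr (real (j * d)) * 2 powr (- (real j * \<beta> * s))"
        by (simp add: powr_add[symmetric] algebra_simps)
      also have "2 powr (real (j * d)) = (2 ^ j) ^ d" by (simp only: powr_realpow power_mult)
      finally show ?thesis by simp
    qed
    finally show "(\<Sum>k\<in>F. h k j) \<le> V * 2 powr (\<beta> * s) * (2 ^ d * real M ^ d) * z ^ j" .
  qed
  also have "\<dots> = V * 2 powr (\<beta> * s) * (2 ^ d * real M ^ d) * (\<Sum>j\<le>J. z ^ j)"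
    by (simp add: sum_distrib_left)
  also have "\<dots> \<le> V * 2 powr (\<beta> * s) * (2 ^ d * real M ^ d) * (1 / (1 - z))"
  proof (rule mult_left_mono)
    have "(\<Sum>j\<le>J. z ^ j) \<le> (\<Sum>j. z ^ j)"
      using z by (intro sum_le_suminf summable_geometric) auto
    then show "(\<Sum>j\<le>J. z ^ j) \<le> 1 / (1 - z)" using z by (simp add: suminf_geometric)
  qed (use V in simp)
  finally show ?thesis by (simp add: V_def z_def d_def mult_ac)
qed

text \<open>Passes from \<open>M\<close> to \<open>L = m powr (1 / CARD('d))\<close>:
  \<open>M \<le> L\<close> bounds the volume factor by \<open>m\<close>, and
  \<open>L \<le> 8 * M\<close> costs a constant in \<open>\<psi>\<close>. All constants are moved
  under one \<open>s\<close>-th power, the form that \<open>ell_norm_le_Holder\<close>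
  takes.\<close>

lemma Psi_tail:
  assumes C: "1 \<le> C" "\<And>x y. 1 \<le> x \<Longrightarrow> x \<le> y \<Longrightarrow> \<psi> y \<le> C * \<psi> x * (x / y) powr \<beta>"
    and s: "0 < s" "real CARD('d) < \<beta> * s"
  obtains C' where "0 < C'" "\<And>m. 1 \<le> m \<Longrightarrow> \<exists>Q :: (int ^ 'd::finite) set. finite Q \<and> card Q \<le> m \<and>
    (\<forall>F. finite F \<longrightarrow> F \<inter> Q = {} \<longrightarrow>
      (\<Sum>k\<in>F. Psi \<psi> r k powr s) \<le> (C' * (\<psi> (real m powr (1 / real CARD('d))) * real m powr (1 / s))) powr s)"
proof -
  obtain C8 where C8: "1 \<le> C8" "\<And>t u. 1 \<le> t \<Longrightarrow> 1 \<le> u \<Longrightarrow> u \<le> 8 * t \<Longrightarrow> \<psi> t \<le> C8 * \<psi> u"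
    using class_B_scaling[OF B, of 8] by auto
  define G where "G = 2 powr (\<beta> * s) * 2 ^ CARD('d) / (1 - 2 powr (real CARD('d) - \<beta> * s))"
  have G: "0 < G"
    using s powr_less_mono[of "real CARD('d) - \<beta> * s" 0 2] by (simp add: G_def)
  show ?thesis
  proof (rule that[of "G powr (1 / s) * (C * C8)"])
    show "0 < G powr (1 / s) * (C * C8)" using G C C8 by simp
    fix m :: nat assume m: "1 \<le> m"
    define L where "L = real m powr (1 / real CARD('d))"
    have L: "1 \<le> L" using root_ge_1[OF m] by (simp add: L_def)
    define n where "n = nat \<lfloor>L / 4\<rfloor>"
    define M where "M = max 1 n"
    have M_le: "real M \<le> L" using L unfolding M_def n_def by linarith
    have M1: "1 \<le> real M" by (simp add: M_def)
    have psiL: "0 < \<psi> L" by (rule class_B_pos[OF B L])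
    have psiM: "0 < \<psi> (real M)" by (rule class_B_pos[OF B M1])
    have le: "\<psi> (real M) \<le> C8 * \<psi> L"
      using le_8_max_floor[of L] L M1 by (intro C8(2)) (auto simp: n_def M_def)
    have "(\<Sum>k\<in>F. Psi \<psi> r k powr s) \<le> (G powr (1 / s) * (C * C8) * (\<psi> L * real m powr (1 / s))) powr s"
      if F: "finite F" "F \<inter> cube n = {}" for F :: "(int ^ 'd) set"
    proof -
      have "(\<Sum>k\<in>F. Psi \<psi> r k powr s) \<le> G * (C * \<psi> (real M)) powr s * real M ^ CARD('d)"
        unfolding G_def by (rule Psi_dyadic_tail[OF C s F M_def])
      also have "\<dots> \<le> G * (C * (C8 * \<psi> L)) powr s * L ^ CARD('d)"
        using G C(1) s le M_le psiM psiL C8(1)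
        by (intro mult_mono powr_mono2 power_mono mult_left_mono) auto
      also have "L ^ CARD('d) = real m"
        using m by (simp add: L_def powr_realpow[symmetric] powr_powr)
      also have "G * (C * (C8 * \<psi> L)) powr s * real m =
          (G powr (1 / s) * (C * C8) * (\<psi> L * real m powr (1 / s))) powr s"
        using G s m by (simp add: powr_mult powr_powr)
      finally show ?thesis .
    qed
    moreover have "card (cube n :: (int ^ 'd) set) \<le> m"
      using two_card_cube_le[OF m n_def[unfolded L_def]] by simp
    ultimately show "\<exists>Q :: (int ^ 'd) set. finite Q \<and> card Q \<le> m \<and>
        (\<forall>F. finite F \<longrightarrow> F \<inter> Q = {} \<longrightarrow> (\<Sum>k\<in>F. Psi \<psi> r k powr s) \<le>
          (G powr (1 / s) * (C * C8) * (\<psi> (real m powr (1 / real CARD('d))) * real m powr (1 / s))) powr s)"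
      unfolding L_def by (intro exI[of _ "cube n"]) auto
  qed
qed

end

section \<open>Widths\<close>

text \<open>The infimum is attained at the Fourier coefficients of \<open>f\<close>; any other
  choice can only enlarge the entries on \<open>\<gamma>\<close>.\<close>

lemma best_approx_eq_ell_norm:
  assumes "0 < p" "finite \<gamma>" "f \<in> L1"
  shows "best_approx p \<gamma> f = ell_norm p (\<lambda>k. if k \<in> \<gamma> then 0 else fourier f k)"
proof -
  have f: "set_integrable lebesgue torus f" using assms(3) by (simp add: L1_def)
  have eq: "fourier (\<lambda>x. f x - (\<Sum>k\<in>\<gamma>. c k * expo k x)) = (\<lambda>k. fourier f k - (if k \<in> \<gamma> then c k else 0))" for c
    by (simp add: fun_eq_iff fourier_diff[OF f set_integrable_trig_poly] fourier_trig_poly[OF assms(2)])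
  have best: "(\<lambda>k. fourier f k - (if k \<in> \<gamma> then fourier f k else 0)) = (\<lambda>k. if k \<in> \<gamma> then 0 else fourier f k)"
    by auto
  show ?thesis
    unfolding best_approx_def Sp_norm_def eq
  proof (rule antisym)
    show "(INF c. ell_norm p (\<lambda>k. fourier f k - (if k \<in> \<gamma> then c k else 0)))
        \<le> ell_norm p (\<lambda>k. if k \<in> \<gamma> then 0 else fourier f k)"
      by (rule INF_lower2[of "fourier f"]) (simp_all only: best UNIV_I order_refl)
    show "ell_norm p (\<lambda>k. if k \<in> \<gamma> then 0 else fourier f k)
        \<le> (INF c. ell_norm p (\<lambda>k. fourier f k - (if k \<in> \<gamma> then c k else 0)))"
      by (intro INF_greatest ell_norm_mono[OF assms(1)]) simp
  qed
qed

text \<open>Sup inf is at most inf sup. It carries upper bounds from the basis width to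
  \<open>m\<close>-term approximation and lower bounds the other way.\<close>

lemma mterm_approx_le_basis_width: "mterm_approx p N m \<le> basis_width p N m"
  unfolding mterm_approx_def basis_width_def
  by (intro SUP_least INF_mono) (auto intro: SUP_upper)

lemma order_equivI:
  assumes "0 < K1" "0 < K2"
    and "\<And>m. 1 \<le> m \<Longrightarrow> 0 \<le> b m"
    and "\<And>m. 1 \<le> m \<Longrightarrow> ennreal (K1 * b m) \<le> a m"
    and "\<And>m. 1 \<le> m \<Longrightarrow> a m \<le> ennreal (K2 * b m)"
  shows "order_equiv a b"
  unfolding order_equiv_def
\<comment> \<open>The definition asks for \<open>K1 < K2\<close>, which the sum of the two constants
  guarantees.\<close>
proof (rule exI[of _ K1], rule exI[of _ "K1 + K2"], intro conjI allI impI)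
  fix m :: nat assume m: "1 \<le> m"
  have "a m \<le> ennreal (K2 * b m)" by (rule assms(5)[OF m])
  also have "\<dots> \<le> ennreal ((K1 + K2) * b m)"
    using assms(1) assms(3)[OF m] by (intro ennreal_leI mult_right_mono) auto
  finally show "a m \<le> ennreal ((K1 + K2) * b m)" .
qed (use assms in auto)

context
  fixes \<psi> :: "real \<Rightarrow> real" and p q r :: ennreal
  assumes B: "\<psi> \<in> class_B" and p: "0 < p" and q: "0 < q" and r: "0 < r"
begin

lemma Fclass_D:
  assumes "f \<in> Fclass q r \<psi>"
  shows "f \<in> L1" "ell_norm q (\<lambda>k. fourier f k / of_real (Psi \<psi> r k)) \<le> 1"
    and "norm (fourier f k) = Psi \<psi> r k * norm (fourier f k / of_real (Psi \<psi> r k))"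
  using assms Psi_pos[OF B r, of k] by (auto simp: Fclass_def norm_divide)

text \<open>The test functions of the lower bounds: after division by weights at least
  \<open>w\<close>, the coefficients are at most \<open>card P\<close> to the power
  \<open>- 1/q\<close>, just small enough for the unit ball.\<close>

lemma trig_poly_in_Fclass:
  fixes P :: "(int ^ 'd::finite) set"
  assumes "finite P" "P \<noteq> {}" "0 \<le> w" "\<And>k. k \<in> P \<Longrightarrow> w \<le> Psi \<psi> r k"
  shows "(\<lambda>x. \<Sum>k\<in>P. of_real (w * real (card P) powr - recip q) * expo k x) \<in> Fclass q r \<psi>"
proof -
  define v where "v = real (card P) powr - recip q"
  have c: "0 < card P" using assms by (simp add: card_gt_0_iff)
  have "ell_norm q (\<lambda>k. (if k \<in> P then of_real (w * v) else 0) / of_real (Psi \<psi> r k) :: complex)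
      \<le> ennreal (v * real (card P) powr recip q)"
  proof (rule ell_norm_le_of_support[OF q assms(1,2)])
    fix k :: "int ^ 'd"
    have "w * v / Psi \<psi> r k \<le> v" if "k \<in> P"
    proof -
      have "w * v \<le> Psi \<psi> r k * v"
        using assms(4)[OF that] by (intro mult_right_mono) (auto simp: v_def)
      then show ?thesis using Psi_pos[OF B r, of k] by (simp add: divide_le_eq mult.commute)
    qed
    then show "norm ((if k \<in> P then of_real (w * v) else 0) / of_real (Psi \<psi> r k) :: complex) \<le> v"
      using assms(3) Psi_pos[OF B r, of k] by (auto simp: norm_divide norm_mult abs_mult v_def)
  qed auto
  also have "v * real (card P) powr recip q = 1" using c by (simp add: v_def powr_add[symmetric])
  finally show ?thesis
    unfolding Fclass_def v_def[symmetric]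
    by (simp add: trig_poly_in_L1 fourier_trig_poly[OF assms(1)] del: of_real_mult)
qed

section \<open>Lower bounds\<close>

lemma best_approx_trig_poly_ge:
  fixes P :: "(int ^ 'd::finite) set"
  assumes "finite P" "finite \<gamma>" "0 \<le> w" "P - \<gamma> \<noteq> {}"
  shows "ennreal (w * real (card (P - \<gamma>)) powr recip p) \<le> best_approx p \<gamma> (\<lambda>x. \<Sum>k\<in>P. of_real w * expo k x)"
  unfolding best_approx_eq_ell_norm[OF p assms(2) trig_poly_in_L1]
  using assms by (intro ell_norm_ge_of_le_on[OF p]) (auto simp: fourier_trig_poly)

lemma mterm_approx_lower:
  obtains c where "0 < c" "\<And>m. 1 \<le> m \<Longrightarrow>
    ennreal (c * (\<psi> (real m powr (1 / real CARD('d))) * real m powr (recip p - recip q)))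
      \<le> mterm_approx p (Fclass q r \<psi> :: (real ^ 'd::finite \<Rightarrow> complex) set) m"
proof -
  obtain c where c: "0 < c" "\<And>m. 1 \<le> m \<Longrightarrow> \<exists>P :: (int ^ 'd::finite) set. finite P \<and> card P = 2 * m \<and>
      (\<forall>k\<in>P. c * \<psi> (real m powr (1 / real CARD('d))) \<le> Psi \<psi> r k)"
    using Psi_lower[OF B r] by blast
  show ?thesis
  proof (rule that[of "2 powr - recip q * c"])
    fix m :: nat assume m: "1 \<le> m"
    define w where "w = c * \<psi> (real m powr (1 / real CARD('d)))"
    have w: "0 < w" using c(1) class_B_pos[OF B root_ge_1[OF m]] by (simp add: w_def)
    obtain P :: "(int ^ 'd) set" where P: "finite P" "card P = 2 * m" "\<And>k. k \<in> P \<Longrightarrow> w \<le> Psi \<psi> r k"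
      using c(2)[OF m] by (auto simp: w_def)
    have Pne: "P \<noteq> {}" using P m by auto
    define u where "u = w * real (card P) powr - recip q"
    have u: "0 \<le> u" using w by (simp add: u_def)
    define f where "f = (\<lambda>x. \<Sum>k\<in>P. of_real u * expo k x)"
    have f: "f \<in> Fclass q r \<psi>"
      unfolding f_def u_def using trig_poly_in_Fclass[OF P(1) Pne _ P(3)] w by simp
    have "ennreal (u * real m powr recip p) \<le> best_approx p \<gamma> f" if \<gamma>: "\<gamma> \<in> Gam m" for \<gamma>
    proof -
      have g: "finite \<gamma>" "card \<gamma> = m" using \<gamma> by (auto simp: Gam_def)
      have le: "m \<le> card (P - \<gamma>)" using diff_card_le_card_Diff[OF g(1), of P] P g by simp
      then have "P - \<gamma> \<noteq> {}" using m by (metis card.empty not_one_le_zero le_zero_eq)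
      from best_approx_trig_poly_ge[OF P(1) g(1) u this]
      have "ennreal (u * real (card (P - \<gamma>)) powr recip p) \<le> best_approx p \<gamma> f" by (simp add: f_def)
      moreover have "ennreal (u * real m powr recip p) \<le> ennreal (u * real (card (P - \<gamma>)) powr recip p)"
        using le u recip_nonneg[of p] by (intro ennreal_leI mult_left_mono powr_mono2) auto
      ultimately show ?thesis by (rule order_trans[rotated])
    qed
    then have "ennreal (u * real m powr recip p) \<le> mterm_approx p (Fclass q r \<psi> :: (real ^ 'd \<Rightarrow> complex) set) m"
      unfolding mterm_approx_def by - (rule SUP_upper2[OF f], rule INF_greatest)
    also have "u * real m powr recip p =
        2 powr - recip q * c * (\<psi> (real m powr (1 / real CARD('d))) * real m powr (recip p - recip q))"
    proof -
      have "real m powr (recip p - recip q) = real m powr - recip q * real m powr recip p"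
        by (simp add: powr_add[symmetric])
      then show ?thesis by (simp add: u_def w_def P(2) powr_mult)
    qed
    finally show "ennreal (2 powr - recip q * c * (\<psi> (real m powr (1 / real CARD('d))) * real m powr (recip p - recip q)))
      \<le> mterm_approx p (Fclass q r \<psi> :: (real ^ 'd \<Rightarrow> complex) set) m" .
  qed (use c in simp)
qed

text \<open>For the width the function may depend on \<open>\<gamma>\<close>, so one frequency of
  \<open>P\<close> outside \<open>\<gamma>\<close> suffices and no power of \<open>m\<close>
  appears; in \<open>mterm_approx_lower\<close> the polynomial is fixed first and has to be spread
  over all of \<open>P\<close>.\<close>

lemma basis_width_lower:
  obtains c where "0 < c" "\<And>m. 1 \<le> m \<Longrightarrow>
    ennreal (c * \<psi> (real m powr (1 / real CARD('d))))
      \<le> basis_width p (Fclass q r \<psi> :: (real ^ 'd::finite \<Rightarrow> complex) set) m"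
proof -
  obtain c where c: "0 < c" "\<And>m. 1 \<le> m \<Longrightarrow> \<exists>P :: (int ^ 'd::finite) set. finite P \<and> card P = 2 * m \<and>
      (\<forall>k\<in>P. c * \<psi> (real m powr (1 / real CARD('d))) \<le> Psi \<psi> r k)"
    using Psi_lower[OF B r] by blast
  show ?thesis
  proof (rule that[OF c(1)])
    fix m :: nat assume m: "1 \<le> m"
    define w where "w = c * \<psi> (real m powr (1 / real CARD('d)))"
    have w: "0 < w" using c(1) class_B_pos[OF B root_ge_1[OF m]] by (simp add: w_def)
    obtain P :: "(int ^ 'd) set" where P: "finite P" "card P = 2 * m" "\<And>k. k \<in> P \<Longrightarrow> w \<le> Psi \<psi> r k"
      using c(2)[OF m] by (auto simp: w_def)
    have "ennreal w \<le> (SUP f\<in>Fclass q r \<psi>. best_approx p \<gamma> f)" if \<gamma>: "\<gamma> \<in> Gam m" for \<gamma> :: "(int ^ 'd) set"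
    proof -
      have g: "finite \<gamma>" "card \<gamma> = m" using \<gamma> by (auto simp: Gam_def)
      have "\<not> P \<subseteq> \<gamma>" using card_mono[OF g(1), of P] P g m by auto
      then obtain k where k: "k \<in> P" "k \<notin> \<gamma>" by auto
      define f where "f = (\<lambda>x. \<Sum>k\<in>{k}. of_real w * expo k x)"
      have "f \<in> Fclass q r \<psi>"
        using trig_poly_in_Fclass[of "{k}" w] w P(3)[OF k(1)] by (simp add: f_def)
      moreover have "{k} - \<gamma> = {k}" using k by auto
      then have "ennreal w \<le> best_approx p \<gamma> f"
        using best_approx_trig_poly_ge[of "{k}" \<gamma> w] w g by (simp add: f_def)
      ultimately show ?thesis by - (rule SUP_upper2)
    qed
    then show "ennreal (c * \<psi> (real m powr (1 / real CARD('d))))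
        \<le> basis_width p (Fclass q r \<psi> :: (real ^ 'd \<Rightarrow> complex) set) m"
      unfolding basis_width_def w_def[symmetric] by (intro INF_greatest)
  qed
qed

section \<open>Upper bounds\<close>

text \<open>The estimate is assumed for every \<open>\<gamma> \<supseteq> Q\<close>, since the
  frequency set is \<open>Q\<close> padded to \<open>m\<close> elements.\<close>

lemma basis_width_le:
  fixes Q :: "(int ^ 'd::finite) set"
  assumes "finite Q" "card Q \<le> m"
    and "\<And>f \<gamma>. f \<in> Fclass q r \<psi> \<Longrightarrow> Q \<subseteq> \<gamma> \<Longrightarrow> ell_norm p (\<lambda>k. if k \<in> \<gamma> then 0 else fourier f k) \<le> V"
  shows "basis_width p (Fclass q r \<psi> :: (real ^ 'd \<Rightarrow> complex) set) m \<le> V"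
proof -
  obtain \<gamma> where \<gamma>: "Q \<subseteq> \<gamma>" "finite \<gamma>" "card \<gamma> = m"
    using exists_superset_card[OF infinite_UNIV_int_vec assms(1,2)] by auto
  then have "\<gamma> \<in> Gam m" by (simp add: Gam_def)
  then have "basis_width p (Fclass q r \<psi> :: (real ^ 'd \<Rightarrow> complex) set) m
      \<le> (SUP f\<in>Fclass q r \<psi>. best_approx p \<gamma> f)"
    unfolding basis_width_def by (rule INF_lower)
  also have "\<dots> \<le> V"
  proof (rule SUP_least)
    fix f :: "real ^ 'd \<Rightarrow> complex" assume f: "f \<in> Fclass q r \<psi>"
    show "best_approx p \<gamma> f \<le> V"
      unfolding best_approx_eq_ell_norm[OF p \<gamma>(2) Fclass_D(1)[OF f]] by (rule assms(3)[OF f \<gamma>(1)])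
  qed
  finally show ?thesis .
qed

lemma basis_width_upper:
  assumes "q \<le> p"
  obtains C where "0 < C" "\<And>m. 1 \<le> m \<Longrightarrow>
    basis_width p (Fclass q r \<psi> :: (real ^ 'd::finite \<Rightarrow> complex) set) m
      \<le> ennreal (C * \<psi> (real m powr (1 / real CARD('d))))"
proof -
  obtain C where C: "0 < C" "\<And>m. 1 \<le> m \<Longrightarrow> \<exists>Q :: (int ^ 'd::finite) set. finite Q \<and> 2 * card Q \<le> m \<and>
      (\<forall>k. k \<notin> Q \<longrightarrow> Psi \<psi> r k \<le> C * \<psi> (real m powr (1 / real CARD('d))))"
    using Psi_upper[OF B r] by blast
  show ?thesis
  proof (rule that[OF C(1)])
    fix m :: nat assume m: "1 \<le> m"
    define V where "V = C * \<psi> (real m powr (1 / real CARD('d)))"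
    have V: "0 < V" using C(1) class_B_pos[OF B root_ge_1[OF m]] by (simp add: V_def)
    obtain Q :: "(int ^ 'd) set" where Q: "finite Q" "2 * card Q \<le> m" "\<And>k. k \<notin> Q \<Longrightarrow> Psi \<psi> r k \<le> V"
      using C(2)[OF m] by (auto simp: V_def)
    show "basis_width p (Fclass q r \<psi> :: (real ^ 'd \<Rightarrow> complex) set) m
        \<le> ennreal (C * \<psi> (real m powr (1 / real CARD('d))))"
      unfolding V_def[symmetric]
    proof (rule basis_width_le[OF Q(1)])
      fix f :: "real ^ 'd \<Rightarrow> complex" and \<gamma>
      assume f: "f \<in> Fclass q r \<psi>" and \<gamma>: "Q \<subseteq> \<gamma>"
      show "ell_norm p (\<lambda>k. if k \<in> \<gamma> then 0 else fourier f k) \<le> ennreal V"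
      proof (rule ell_norm_le_mult[OF q assms Fclass_D(2)[OF f]])
        fix k
        have "norm (fourier f k) \<le> V * norm (fourier f k / of_real (Psi \<psi> r k))" if "k \<notin> \<gamma>"
          unfolding Fclass_D(3)[OF f, of k] using Q(3)[of k] \<gamma> that by (intro mult_right_mono) auto
        then show "norm (if k \<in> \<gamma> then 0 else fourier f k) \<le> V * norm (fourier f k / of_real (Psi \<psi> r k))"
          using V by simp
      qed (use V in simp)
    qed (use Q in simp)
  qed
qed

lemma basis_width_upper_decay:
  assumes "p < q"
    and C: "1 \<le> C" "\<And>x y. 1 \<le> x \<Longrightarrow> x \<le> y \<Longrightarrow> \<psi> y \<le> C * \<psi> x * (x / y) powr \<beta>"
    and \<beta>: "real CARD('d) * (recip p - recip q) < \<beta>"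
  obtains C where "0 < C" "\<And>m. 1 \<le> m \<Longrightarrow>
    basis_width p (Fclass q r \<psi> :: (real ^ 'd::finite \<Rightarrow> complex) set) m
      \<le> ennreal (C * (\<psi> (real m powr (1 / real CARD('d))) * real m powr (recip p - recip q)))"
proof -
  define s where "s = 1 / (recip p - recip q)"
  have s: "0 < s" "1 / s = recip p - recip q"
    using recip_strict_antimono[OF p assms(1)] by (auto simp: s_def)
  \<comment> \<open>In this form the lower bound on \<open>\<beta>\<close> makes the dyadic series
    of \<open>Psi_dyadic_tail\<close> converge.\<close>
  have "real CARD('d) < \<beta> * s"
    using \<beta> s(1) unfolding s(2)[symmetric] by (simp add: field_simps)
  from Psi_tail[OF B r C s(1) this] obtain C' where C': "0 < C'"
    "\<And>m. 1 \<le> m \<Longrightarrow> \<exists>Q :: (int ^ 'd) set. finite Q \<and> card Q \<le> m \<and>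
      (\<forall>F. finite F \<longrightarrow> F \<inter> Q = {} \<longrightarrow>
      (\<Sum>k\<in>F. Psi \<psi> r k powr s) \<le> (C' * (\<psi> (real m powr (1 / real CARD('d))) * real m powr (1 / s))) powr s)"
    by blast
  show ?thesis
  proof (rule that[of "2 powr recip p * C'"])
    fix m :: nat assume m: "1 \<le> m"
    define M where "M = C' * (\<psi> (real m powr (1 / real CARD('d))) * real m powr (1 / s))"
    have M: "0 < M" using C'(1) class_B_pos[OF B root_ge_1[OF m]] m by (simp add: M_def)
    obtain Q :: "(int ^ 'd) set" where Q: "finite Q" "card Q \<le> m"
      "\<And>F. finite F \<Longrightarrow> F \<inter> Q = {} \<Longrightarrow> (\<Sum>k\<in>F. Psi \<psi> r k powr s) \<le> M powr s"
      using C'(2)[OF m] unfolding M_def by blast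
    have "basis_width p (Fclass q r \<psi> :: (real ^ 'd \<Rightarrow> complex) set) m \<le> ennreal (2 powr recip p * M)"
    proof (rule basis_width_le[OF Q(1,2)])
      fix f :: "real ^ 'd \<Rightarrow> complex" and \<gamma>
      assume f: "f \<in> Fclass q r \<psi>" and \<gamma>: "Q \<subseteq> \<gamma>"
      \<comment> \<open>The weights are cut off on \<open>\<gamma>\<close>, so that only points
        outside \<open>Q\<close> enter the sum of their \<open>s\<close>-th powers.\<close>
      define w where "w = (\<lambda>k. if k \<in> \<gamma> then 0 else Psi \<psi> r k)"
      show "ell_norm p (\<lambda>k. if k \<in> \<gamma> then 0 else fourier f k) \<le> ennreal (2 powr recip p * M)"
      proof (rule ell_norm_le_Holder[OF p assms(1) Fclass_D(2)[OF f] M _ _ s(2)])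
        show "norm (if k \<in> \<gamma> then 0 else fourier f k) \<le> w k * norm (fourier f k / of_real (Psi \<psi> r k))" for k
          using Fclass_D(3)[OF f, of k] by (simp add: w_def)
        show "0 \<le> w k" for k using Psi_pos[OF B r, of k] by (simp add: w_def)
        fix F :: "(int ^ 'd) set" assume F: "finite F"
        have "(\<Sum>k\<in>F. w k powr s) = (\<Sum>k\<in>F - \<gamma>. Psi \<psi> r k powr s)"
          using F by (intro sum.mono_neutral_cong_right) (auto simp: w_def)
        also have "\<dots> \<le> M powr s" using F \<gamma> by (intro Q(3)) auto
        finally show "(\<Sum>k\<in>F. w k powr s) \<le> M powr s" .
      qed
    qed
    then show "basis_width p (Fclass q r \<psi> :: (real ^ 'd \<Rightarrow> complex) set) m
        \<le> ennreal (2 powr recip p * C' * (\<psi> (real m powr (1 / real CARD('d))) * real m powr (recip p - recip q)))"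
      by (simp add: M_def s(2) mult.assoc)
  qed (use C' in simp)
qed

text \<open>Here \<open>\<gamma>\<close> may depend on \<open>f\<close> and take its large
  coefficients, which gains the power of \<open>m\<close> over the basis width.\<close>

lemma mterm_approx_upper:
  assumes "q < p"
  obtains C where "0 < C" "\<And>m. 1 \<le> m \<Longrightarrow>
    mterm_approx p (Fclass q r \<psi> :: (real ^ 'd::finite \<Rightarrow> complex) set) m
      \<le> ennreal (C * (\<psi> (real m powr (1 / real CARD('d))) * real m powr (recip p - recip q)))"
proof -
  obtain C where C: "0 < C" "\<And>m. 1 \<le> m \<Longrightarrow> \<exists>Q :: (int ^ 'd::finite) set. finite Q \<and> 2 * card Q \<le> m \<and>
      (\<forall>k. k \<notin> Q \<longrightarrow> Psi \<psi> r k \<le> C * \<psi> (real m powr (1 / real CARD('d))))"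
    using Psi_upper[OF B r] by blast
  show ?thesis
  proof (rule that[of "2 powr recip q * C"])
    fix m :: nat assume m: "1 \<le> m"
    define V where "V = C * \<psi> (real m powr (1 / real CARD('d)))"
    have V: "0 < V" using C(1) class_B_pos[OF B root_ge_1[OF m]] by (simp add: V_def)
    obtain Q :: "(int ^ 'd) set" where Q: "finite Q" "2 * card Q \<le> m" "\<And>k. k \<notin> Q \<Longrightarrow> Psi \<psi> r k \<le> V"
      using C(2)[OF m] by (auto simp: V_def)
    have "mterm_approx p (Fclass q r \<psi> :: (real ^ 'd \<Rightarrow> complex) set) m
        \<le> ennreal (2 powr recip q * V * real m powr (recip p - recip q))"
      unfolding mterm_approx_def
    proof (rule SUP_least)
      fix f :: "real ^ 'd \<Rightarrow> complex" assume f: "f \<in> Fclass q r \<psi>"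
      have "norm (fourier f k) \<le> V * norm (fourier f k / of_real (Psi \<psi> r k))" if "k \<notin> Q" for k
        unfolding Fclass_D(3)[OF f, of k] using Q(3)[OF that] by (intro mult_right_mono) auto
      from exists_sparse_ell_norm_le[OF q assms Fclass_D(2)[OF f] infinite_UNIV_int_vec Q(1,2) m V this]
      obtain \<gamma> where \<gamma>: "finite \<gamma>" "card \<gamma> = m"
        "ell_norm p (\<lambda>k. if k \<in> \<gamma> then 0 else fourier f k)
          \<le> ennreal (2 powr recip q * V * real m powr (recip p - recip q))" by blast
      then have "\<gamma> \<in> Gam m" by (simp add: Gam_def)
      then show "(INF \<gamma>\<in>Gam m. best_approx p \<gamma> f) \<le> ennreal (2 powr recip q * V * real m powr (recip p - recip q))"
        using \<gamma>(3) unfolding best_approx_eq_ell_norm[OF p \<gamma>(1) Fclass_D(1)[OF f], symmetric]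
        by (rule INF_lower2)
    qed
    then show "mterm_approx p (Fclass q r \<psi> :: (real ^ 'd \<Rightarrow> complex) set) m
        \<le> ennreal (2 powr recip q * C * (\<psi> (real m powr (1 / real CARD('d))) * real m powr (recip p - recip q)))"
      by (simp add: V_def mult.assoc)
  qed (use C in simp)
qed

end

section \<open>The orders of both quantities\<close>

theorem theorem2:
  fixes p q r :: ennreal and \<psi> :: "real \<Rightarrow> real"
  assumes "0 < p" and "0 < q" and "0 < r"
    and "\<psi> \<in> class_B"
    and "p < q \<Longrightarrow> \<exists>t0 \<beta>. 1 \<le> t0 \<and> \<beta> > real CARD('d) * (recip p - recip q) \<and>
           convex_on {t0<..} \<psi> \<and>
           (\<forall>t>t0. \<exists>D. (\<psi> has_real_derivative D) (at_right t) \<and> t * \<bar>D\<bar> / \<psi> t \<ge> \<beta>)"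
  shows "order_equiv (basis_width p (Fclass q r \<psi> :: (real ^ 'd::finite \<Rightarrow> complex) set))
           (\<lambda>m. if q \<le> p then \<psi> (real m powr (1 / real CARD('d)))
                else \<psi> (real m powr (1 / real CARD('d))) * real m powr (recip p - recip q))
       \<and> order_equiv (mterm_approx p (Fclass q r \<psi> :: (real ^ 'd \<Rightarrow> complex) set))
           (\<lambda>m. \<psi> (real m powr (1 / real CARD('d))) * real m powr (recip p - recip q))"
proof -
  note ctx = assms(4,1,2,3)
  let ?F = "Fclass q r \<psi> :: (real ^ 'd \<Rightarrow> complex) set"
  define W where "W = (\<lambda>m. \<psi> (real m powr (1 / real CARD('d))))"
  define R where "R = (\<lambda>m. W m * real m powr (recip p - recip q))"
  have W: "0 \<le> W m" if "1 \<le> m" for m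
    unfolding W_def by (rule less_imp_le[OF class_B_pos[OF assms(4) root_ge_1[OF that]]])
  have R: "0 \<le> R m" if "1 \<le> m" for m using W[OF that] by (simp add: R_def)
  obtain c where c: "0 < c" "\<And>m. 1 \<le> m \<Longrightarrow> ennreal (c * R m) \<le> mterm_approx p ?F m"
    using mterm_approx_lower[OF ctx] unfolding R_def W_def by blast
  have "order_equiv (basis_width p ?F) (if q \<le> p then W else R) \<and> order_equiv (mterm_approx p ?F) R"
  proof (cases "q \<le> p")
    case True
    obtain c' where c': "0 < c'" "\<And>m. 1 \<le> m \<Longrightarrow> ennreal (c' * W m) \<le> basis_width p ?F m"
      using basis_width_lower[OF ctx] unfolding W_def by blast
    obtain C' where C': "0 < C'" "\<And>m. 1 \<le> m \<Longrightarrow> basis_width p ?F m \<le> ennreal (C' * W m)"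
      using basis_width_upper[OF ctx True] unfolding W_def by blast
    \<comment> \<open>Thresholding needs \<open>q < p\<close>; at \<open>q = p\<close> the power of
      \<open>m\<close> is 1 and the bound for the width serves.\<close>
    obtain C where C: "0 < C" "\<And>m. 1 \<le> m \<Longrightarrow> mterm_approx p ?F m \<le> ennreal (C * R m)"
    proof (cases "q = p")
      case True
      have "mterm_approx p ?F m \<le> ennreal (C' * R m)" if "1 \<le> m" for m
        using order_trans[OF mterm_approx_le_basis_width C'(2)[OF that]] that True by (simp add: R_def)
      then show thesis by (rule that[OF C'(1)])
    next
      case False
      with True have "q < p" by simp
      from mterm_approx_upper[OF ctx this] show thesis
        using that unfolding R_def W_def by blast
    qed
    show ?thesis
      using order_equivI[OF c'(1) C'(1) W c'(2) C'(2)] order_equivI[OF c(1) C(1) R c(2) C(2)] True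
      by simp
  next
    case False
    then have pq: "p < q" by simp
    obtain t0 \<beta> where t0: "1 \<le> t0" "real CARD('d) * (recip p - recip q) < \<beta>" "convex_on {t0<..} \<psi>"
      "\<And>t. t0 < t \<Longrightarrow> \<exists>D. (\<psi> has_real_derivative D) (at_right t) \<and> \<beta> \<le> t * \<bar>D\<bar> / \<psi> t"
      using assms(5)[OF pq] by blast
    have "0 \<le> real CARD('d) * (recip p - recip q)"
      using recip_strict_antimono[OF assms(1) pq] by simp
    then have \<beta>: "0 \<le> \<beta>" using t0(2) by linarith
    obtain K where K: "1 \<le> K" "\<And>x y. 1 \<le> x \<Longrightarrow> x \<le> y \<Longrightarrow> \<psi> y \<le> K * \<psi> x * (x / y) powr \<beta>"
      using class_B_power_decay[OF assms(4) t0(1) \<beta> t0(3,4)] by blast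
    obtain C where C: "0 < C" "\<And>m. 1 \<le> m \<Longrightarrow> basis_width p ?F m \<le> ennreal (C * R m)"
      using basis_width_upper_decay[OF ctx pq K t0(2)] unfolding R_def W_def by blast
    \<comment> \<open>For \<open>p < q\<close> both quantities have the same order, so the lower
      bound for \<open>m\<close>-term approximation and the upper bound for the width settle
      everything.\<close>
    have lower: "ennreal (c * R m) \<le> basis_width p ?F m" if "1 \<le> m" for m
      using order_trans[OF c(2)[OF that] mterm_approx_le_basis_width] .
    have upper: "mterm_approx p ?F m \<le> ennreal (C * R m)" if "1 \<le> m" for m
      using order_trans[OF mterm_approx_le_basis_width C(2)[OF that]] .
    show ?thesis
      using order_equivI[OF c(1) C(1) R lower C(2)] order_equivI[OF c(1) C(1) R c(2) upper] False
      by simp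
  qed
  moreover have "(\<lambda>m. if q \<le> p then \<psi> (real m powr (1 / real CARD('d)))
      else \<psi> (real m powr (1 / real CARD('d))) * real m powr (recip p - recip q)) = (if q \<le> p then W else R)"
    by (simp add: fun_eq_iff W_def R_def)
  ultimately show ?thesis by (simp add: R_def W_def)
qed

end
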